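(* Let $\mathfrak g=\mathfrak{pe}(n)$ be the periplectic Lie superalgebra and let $\phi$ be the map $x\mapsto(\mathfrak p(x),\mathfrak l(x)):=(\mathfrak p(\zeta_x),\mathfrak l(\zeta_x))$ from $\mathrm{BRP}_n$ to the set of parabolic decompositions of $\mathfrak{pe}(n)$. (i) The map $\phi$ yields a bijection between $\mathrm{BRP}_n$ and the set $\{(\mathfrak p,\mathfrak l)\mid\mathfrak p\supset\mathfrak b_{\bar 0}^s\}$ of all parabolic decompositions with parabolic subalgebra containing $\mathfrak b^s_{\bar 0}$. (ii) The map $\phi$ (via $x\mapsto\mathfrak p(x)$) yields a bijection between $\mathrm{BRP}_n^0$ and the set of all reduced parabolic subalgebras containing $\mathfrak b_{\bar 0}^s$. (iii) The map $\phi$ (via $x\mapsto\mathfrak p(x)$) yields a bijection between $\mathrm{BRP}_n^{00}$ and the set $\mathrm{Bor}(\mathfrak g,\mathfrak b_{\bar 0}^s)$ of Borel subalgebras of $\mathfrak g$ with even part $\mathfrak b_{\bar 0}^s$.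
   Context: **Periplectic Lie superalgebra.** $\mathfrak{pe}(n)=\left\{\begin{pmatrix}A&B\\C&-A^t\end{pmatrix}: A,B,C\in\mathbb C^{n\times n},\ B^t=B,\ C^t=-C\right\}\subset\mathfrak{gl}(n|n)$, $n\ge1$, with supercommutator bracket; even part $\{B=C=0\}\cong\mathfrak{gl}(n)$. $\mathfrak h=\mathfrak h_{\bar 0}$ is the subalgebra of diagonal matrices, and $\epsilon_1,\dots,\epsilon_n\in\mathfrak h^*$ is the basis dual to $\{E_{ii}-E_{n+i,n+i}\}$. The set of roots is $\Phi=\{\epsilon_i-\epsilon_j\mid i\ne j\}\sqcup\{\epsilon_i+\epsilon_j\mid i\le j\}\sqcup\{-\epsilon_i-\epsilon_j\mid i<j\}$; the roots $\epsilon_i-\epsilon_j$ are even, the others odd. $\mathfrak b_{\bar 0}^s\subset\mathfrak g_{\bar 0}$ consists of matrices with $B=C=0$ and $A$ upper triangular. $(\cdot,\cdot)$ is the bilinear form on $\mathfrak h^*$ with $(\epsilon_i,\epsilon_j)=\delta_{ij}$. **Parabolic decompositions.** For $\delta\in\mathfrak h^*$: $\mathfrak l(\delta)=\bigoplus_{\mathrm{Re}(\delta,\alpha)=0}\mathfrak g^\alpha$, $\mathfrak u^\pm(\delta)=\bigoplus_{\pm\mathrm{Re}(\delta,\alpha)>0}\mathfrak g^\alpha$ (over $\alpha\in\Phi\cup\{0\}$), $\mathfrak p(\delta)=\mathfrak l(\delta)\oplus\mathfrak u^+(\delta)$. A parabolic decomposition is (the decomposition $\mathfrak u^-\oplus\mathfrak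 l\oplus\mathfrak u^+$ determined by) a pair $(\mathfrak p(\delta),\mathfrak l(\delta))$; the $\mathfrak p(\delta)$ are the parabolic subalgebras. A parabolic subalgebra $\mathfrak p$ is reduced if it equals $\mathfrak p(\delta)$ for some $\delta$ with $\mathfrak l(\delta)$ purely even. A Borel subalgebra is $\mathfrak p(\delta)$ for some $\delta$ with $\mathfrak l(\delta)=\mathfrak h$. **Bipartitions.** $\mathrm{RP}_n$ (resp. $\mathrm{RP}_n^0$) is the set of partitions $\lambda=(\lambda_1,\lambda_2,\dots)$ (eventually zero) with $0\le\lambda_i-\lambda_{i+1}\le1$ for all $i$, of length $\le n$ (resp. exactly $n$). $\partial^n=(n,n-1,\dots,1)$. For a bipartition (pair of partitions) $(\mu,\nu)$, $\mu\ast\nu$ is the partition obtained by sorting all the parts of $\mu$ and $\nu$ together. $\mathrm{BRP}_n$ is the set of bipartitions $(\mu,\nu)$ with $\mu\ast\nu\in\mathrm{RP}_n$; $\mathrm{BRP}^0_n\subset\mathrm{BRP}_n$ is the set of those with $\mu\ast\nu\in\mathrm{RP}^0_n$ and such that $\mu_i=\nu_j$ implies $\mu_i=\nu_j=0$; $\mathrm{BRP}_n^{00}\subset\mathrm{BRP}_n^0$ is the set of those with $\mu\ast\nu=\partial^n$. For $x=(\mu,\nu)\in\mathrm{BRP}_n$, $\zeta_x=\sum_{i\ge1}\mu_i\epsilon_i-\sum_{j\ge1}\nu_j\epsilon_{n+1-j}\in\mathfrak h^*$. *)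

theory Defs
  imports Jordan_Normal_Form.Matrix "HOL-Library.Multiset"
begin

text \<open>All indices are 0-based: for instance \<^term>\<open>unit_vec n i\<close> is the functional that is
  written $\epsilon_{i+1}$ in the usual 1-based notation.\<close>

subsection \<open>The periplectic Lie superalgebra\<close>

definition periplectic :: "nat \<Rightarrow> complex mat set" where
  "periplectic n = {four_block_mat A B C (- A\<^sup>T) | A B C.
     A \<in> carrier_mat n n \<and> B \<in> carrier_mat n n \<and> C \<in> carrier_mat n n \<and> B\<^sup>T = B \<and> C\<^sup>T = - C}"

definition periplectic_even :: "nat \<Rightarrow> complex mat set" where
  "periplectic_even n =
     {four_block_mat A (0\<^sub>m n n) (0\<^sub>m n n) (- A\<^sup>T) | A. A \<in> carrier_mat n n}"

definition even_part :: "nat \<Rightarrow> complex mat \<Rightarrow> complex mat" where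
  "even_part n X = mat (2*n) (2*n) (\<lambda>(i, j). if (i < n) = (j < n) then X $$ (i, j) else 0)"

definition odd_part :: "nat \<Rightarrow> complex mat \<Rightarrow> complex mat" where
  "odd_part n X = mat (2*n) (2*n) (\<lambda>(i, j). if (i < n) = (j < n) then 0 else X $$ (i, j))"

text \<open>The bilinear extension of $[X,Y] = XY - (-1)^{|X||Y|} YX$ from homogeneous elements
  to all of $\mathfrak{gl}(n|n)$.\<close>

definition supercommutator :: "nat \<Rightarrow> complex mat \<Rightarrow> complex mat \<Rightarrow> complex mat" where
  "supercommutator n X Y =
     X * Y - (even_part n Y * even_part n X + even_part n Y * odd_part n X
              + odd_part n Y * even_part n X - odd_part n Y * odd_part n X)"

definition cartan :: "nat \<Rightarrow> complex mat set" where
  "cartan n = {H \<in> periplectic n. diagonal_mat H}"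

definition std_even_borel :: "nat \<Rightarrow> complex mat set" where
  "std_even_borel n =
     {four_block_mat A (0\<^sub>m n n) (0\<^sub>m n n) (- A\<^sup>T) | A. A \<in> carrier_mat n n \<and> upper_triangular A}"

subsection \<open>Weights, roots and root spaces\<close>

text \<open>An element of $\mathfrak h^*$ is given by its coordinate vector with respect to the basis
  dual to the matrices $E_{ii} - E_{n+i,n+i}$. In these coordinates the form with orthonormal
  basis $\epsilon_1, \dots, \epsilon_n$ is \<^const>\<open>scalar_prod\<close>, which is bilinear
  (no complex conjugation).\<close>

abbreviation cartan_dual :: "nat \<Rightarrow> complex vec set" where
  "cartan_dual n \<equiv> carrier_vec n"

definition weight_eval :: "nat \<Rightarrow> complex vec \<Rightarrow> complex mat \<Rightarrow> complex" where
  "weight_eval n \<alpha> H = (\<Sum>i<n. \<alpha> $ i * H $$ (i, i))"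

definition roots :: "nat \<Rightarrow> complex vec set" where
  "roots n =
     {unit_vec n i - unit_vec n j | i j. i < n \<and> j < n \<and> i \<noteq> j}
     \<union> {unit_vec n i + unit_vec n j | i j. i \<le> j \<and> j < n}
     \<union> {- unit_vec n i - unit_vec n j | i j. i < j \<and> j < n}"

definition root_space :: "nat \<Rightarrow> complex vec \<Rightarrow> complex mat set" where
  "root_space n \<alpha> =
     {X \<in> periplectic n. \<forall>H\<in>cartan n. supercommutator n H X = weight_eval n \<alpha> H \<cdot>\<^sub>m X}"

text \<open>The sum of the root spaces for the weights in the finite set \<open>S\<close>; the type of matrices
  has no zero, so the sum of the components is taken entrywise.\<close>

definition root_space_sum :: "nat \<Rightarrow> complex vec set \<Rightarrow> complex mat set" where
  "root_space_sum n S =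
     {mat (2*n) (2*n) (\<lambda>ij. \<Sum>\<alpha>\<in>S. X \<alpha> $$ ij) | X. \<forall>\<alpha>\<in>S. X \<alpha> \<in> root_space n \<alpha>}"

subsection \<open>Parabolic decompositions\<close>

definition levi :: "nat \<Rightarrow> complex vec \<Rightarrow> complex mat set" where
  "levi n \<delta> = root_space_sum n {\<alpha> \<in> roots n \<union> {0\<^sub>v n}. Re (scalar_prod \<delta> \<alpha>) = 0}"

definition nilrad_plus :: "nat \<Rightarrow> complex vec \<Rightarrow> complex mat set" where
  "nilrad_plus n \<delta> = root_space_sum n {\<alpha> \<in> roots n \<union> {0\<^sub>v n}. Re (scalar_prod \<delta> \<alpha>) > 0}"

definition parabolic :: "nat \<Rightarrow> complex vec \<Rightarrow> complex mat set" where
  "parabolic n \<delta> = {X + Y | X Y. X \<in> levi n \<delta> \<and> Y \<in> nilrad_plus n \<delta>}"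

definition parabolic_decompositions :: "nat \<Rightarrow> (complex mat set \<times> complex mat set) set" where
  "parabolic_decompositions n = {(parabolic n \<delta>, levi n \<delta>) | \<delta>. \<delta> \<in> cartan_dual n}"

definition reduced_parabolics :: "nat \<Rightarrow> complex mat set set" where
  "reduced_parabolics n =
     {parabolic n \<delta> | \<delta>. \<delta> \<in> cartan_dual n \<and> levi n \<delta> \<subseteq> periplectic_even n}"

definition borels :: "nat \<Rightarrow> complex mat set set" where
  "borels n = {parabolic n \<delta> | \<delta>. \<delta> \<in> cartan_dual n \<and> levi n \<delta> = cartan n}"

subsection \<open>Partitions and bipartitions\<close>

definition is_partition :: "(nat \<Rightarrow> nat) \<Rightarrow> bool" where
  "is_partition \<kappa> \<longleftrightarrow> antimono \<kappa> \<and> finite {i. \<kappa> i \<noteq> 0}"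

definition partition_length :: "(nat \<Rightarrow> nat) \<Rightarrow> nat" where
  "partition_length \<kappa> = card {i. \<kappa> i \<noteq> 0}"

definition parts :: "(nat \<Rightarrow> nat) \<Rightarrow> nat multiset" where
  "parts \<kappa> = image_mset \<kappa> (mset_set {i. \<kappa> i \<noteq> 0})"

definition partition_of_parts :: "nat multiset \<Rightarrow> nat \<Rightarrow> nat" where
  "partition_of_parts M i = (if i < size M then rev (sorted_list_of_multiset M) ! i else 0)"

definition partition_merge :: "(nat \<Rightarrow> nat) \<Rightarrow> (nat \<Rightarrow> nat) \<Rightarrow> (nat \<Rightarrow> nat)" where
  "partition_merge \<mu> \<nu> = partition_of_parts (parts \<mu> + parts \<nu>)"

definition RP :: "nat \<Rightarrow> (nat \<Rightarrow> nat) set" where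
  "RP n = {\<kappa>. is_partition \<kappa> \<and> (\<forall>i. \<kappa> i \<le> \<kappa> (Suc i) + 1) \<and> partition_length \<kappa> \<le> n}"

definition RP0 :: "nat \<Rightarrow> (nat \<Rightarrow> nat) set" where
  "RP0 n = {\<kappa>. is_partition \<kappa> \<and> (\<forall>i. \<kappa> i \<le> \<kappa> (Suc i) + 1) \<and> partition_length \<kappa> = n}"

definition staircase :: "nat \<Rightarrow> nat \<Rightarrow> nat" where
  "staircase n i = n - i"

definition BRP :: "nat \<Rightarrow> ((nat \<Rightarrow> nat) \<times> (nat \<Rightarrow> nat)) set" where
  "BRP n = {(\<mu>, \<nu>). is_partition \<mu> \<and> is_partition \<nu> \<and> partition_merge \<mu> \<nu> \<in> RP n}"

definition BRP0 :: "nat \<Rightarrow> ((nat \<Rightarrow> nat) \<times> (nat \<Rightarrow> nat)) set" where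
  "BRP0 n = {(\<mu>, \<nu>) \<in> BRP n. partition_merge \<mu> \<nu> \<in> RP0 n
               \<and> (\<forall>i j. \<mu> i = \<nu> j \<longrightarrow> \<mu> i = 0 \<and> \<nu> j = 0)}"

definition BRP00 :: "nat \<Rightarrow> ((nat \<Rightarrow> nat) \<times> (nat \<Rightarrow> nat)) set" where
  "BRP00 n = {(\<mu>, \<nu>) \<in> BRP0 n. partition_merge \<mu> \<nu> = staircase n}"

text \<open>The weight $\sum_i \mu_i \epsilon_i - \sum_j \nu_j \epsilon_{n+1-j}$. Both partitions have at
  most \<open>n\<close> non-zero parts for elements of \<^term>\<open>BRP n\<close>, so no term of the sums is lost.\<close>

definition zeta :: "nat \<Rightarrow> (nat \<Rightarrow> nat) \<times> (nat \<Rightarrow> nat) \<Rightarrow> complex vec" where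
  "zeta n x = vec n (\<lambda>k. of_nat (fst x k) - of_nat (snd x (n - 1 - k)))"

end

theory Submission
  imports Defs
begin

text \<open>An element of a root space of the periplectic Lie superalgebra is supported on one entry and its
  mirror image. Hence, writing $s = (d_1, \dots, d_n, -d_1, \dots, -d_n)$ for
  $d = \mathrm{Re}\,\delta$, the Levi and parabolic subalgebras consist of the matrices supported
  on the entries $(a,b)$ with $s_a = s_b$ and $s_a \ge s_b$, respectively, so the parabolic
  decomposition is equivalent to the weak order of the signed coordinates $s$. Each such order has
  a unique representative with integer coordinates whose nonzero absolute values are
  $\{1, \dots, m\}$: replace each coordinate by the rank of its absolute value and keep the sign.
  The dominant ones among these vectors are exactly the weights of bipartitions: the positive
  coordinates are the parts of $\mu$ and the negative ones those of $\nu$.\<close>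

subsection \<open>Entries of periplectic matrices\<close>

text \<open>The obstacle is an asymmetry of the roots: 2\<epsilon> is a root and -2\<epsilon> is
  not, so a parabolic subalgebra alone need not see whether a coordinate is zero or positive. For n
  = 1 both d = 0 and d = 1 give the whole algebra, with different Levi subalgebras. Hence the first
  bijection is about pairs; in the other two the condition on the Levi subalgebra makes every
  coordinate nonzero, and the parabolic subalgebra suffices.

  The other conditions are also properties of the order. Containing the even Borel subalgebra says
  that d is weakly decreasing, an even Levi subalgebra says that d_i + d_j is never 0 (i = j
  included), and a Levi subalgebra equal to the Cartan subalgebra says in addition that the d_i are
  distinct. On integral representatives the second condition means n nonzero parts in all and none
  common to \<mu> and \<nu>, and the third that each of 1, ..., n occurs once.

  Uniqueness of the representative is a minimality argument: among the integer vectors with a given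
  order, the one without gaps has the least absolute value in every coordinate.\<close>

definition flip :: "nat \<Rightarrow> nat \<Rightarrow> nat" where
  "flip n a = (if a < n then a + n else a - n)"

text \<open>The algebra is the fixed space of the involution that moves entry (a, b) to its mirror
  (\<open>flip n b\<close>, \<open>flip n a\<close>) with this sign. The sign is + only on the
  symmetric upper right block; it is - for the skew lower left block and for the two diagonal blocks
  A and -A^t.\<close>

definition flip_sign :: "nat \<Rightarrow> nat \<Rightarrow> nat \<Rightarrow> complex" where
  "flip_sign n a b = (if a < n \<and> \<not> b < n then 1 else - 1)"

lemma flip_less: "a < 2 * n \<Longrightarrow> flip n a < 2 * n"
  by (auto simp: flip_def)

lemma flip_less_iff: "a < 2 * n \<Longrightarrow> flip n a < n \<longleftrightarrow> \<not> a < n"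
  by (auto simp: flip_def)

lemma flip_flip: "a < 2 * n \<Longrightarrow> flip n (flip n a) = a"
  by (auto simp: flip_def)

lemma flip_sign_flip:
  "a < 2 * n \<Longrightarrow> b < 2 * n \<Longrightarrow> flip_sign n (flip n b) (flip n a) = flip_sign n a b"
  by (auto simp: flip_sign_def flip_less_iff)

lemma flip_sign_square: "flip_sign n a b * flip_sign n a b = 1"
  by (auto simp: flip_sign_def)

text \<open>Turns the block conditions into one equation per entry, so that later arguments about
  supports need no case split over blocks.\<close>

lemma periplectic_iff:
  "X \<in> periplectic n \<longleftrightarrow> X \<in> carrier_mat (2 * n) (2 * n) \<and>
     (\<forall>a<2*n. \<forall>b<2*n. X $$ (a, b) = flip_sign n a b * X $$ (flip n b, flip n a))"
  (is "?L \<longleftrightarrow> ?R")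
proof
  assume ?L
  then obtain A B C where X: "X = four_block_mat A B C (- A\<^sup>T)"
    and A: "A \<in> carrier_mat n n" and B: "B \<in> carrier_mat n n" and C: "C \<in> carrier_mat n n"
    and Bt: "B\<^sup>T = B" and Ct: "C\<^sup>T = - C"
    unfolding periplectic_def by blast
  have b: "B $$ (i, j) = B $$ (j, i)" if "i < n" "j < n" for i j
  proof -
    have "B\<^sup>T $$ (i, j) = B $$ (j, i)" using that B by simp
    with Bt show ?thesis by simp
  qed
  have c: "C $$ (i, j) = - C $$ (j, i)" if "i < n" "j < n" for i j
  proof -
    have "C\<^sup>T $$ (j, i) = C $$ (i, j)" using that C by simp
    moreover have "(- C) $$ (j, i) = - C $$ (j, i)" using that C by simp
    ultimately show ?thesis using Ct by simp
  qed
  have "X $$ (a, b) = flip_sign n a b * X $$ (flip n b, flip n a)" if "a < 2*n" "b < 2*n" for a b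
    using that A B C b[of a "b - n"] c[of "a - n" b]
    by (auto simp: X flip_sign_def flip_def)
  moreover have "X \<in> carrier_mat (2*n) (2*n)"
    using A B C by (auto simp: X)
  ultimately show ?R by blast
next
  assume R: ?R
  then have Xc: "X \<in> carrier_mat (2*n) (2*n)" by blast
  have sym: "X $$ (a, b) = flip_sign n a b * X $$ (flip n b, flip n a)"
    if "a < 2*n" "b < 2*n" for a b
    using R that by blast
  define A where "A = mat n n (\<lambda>(i, j). X $$ (i, j))"
  define B where "B = mat n n (\<lambda>(i, j). X $$ (i, j + n))"
  define C where "C = mat n n (\<lambda>(i, j). X $$ (i + n, j))"
  have "X = four_block_mat A B C (- A\<^sup>T)"
  proof (rule eq_matI)
    fix a b assume "a < dim_row (four_block_mat A B C (- A\<^sup>T))" "b < dim_col (four_block_mat A B C (- A\<^sup>T))"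
    then have ab: "a < 2*n" "b < 2*n" by (auto simp: A_def)
    show "X $$ (a, b) = four_block_mat A B C (- A\<^sup>T) $$ (a, b)"
      using ab sym[OF ab] by (auto simp: A_def B_def C_def flip_sign_def flip_def)
  qed (use Xc in \<open>auto simp: A_def\<close>)
  moreover have "B\<^sup>T = B"
  proof (rule eq_matI)
    fix i j assume "i < dim_row B" "j < dim_col B"
    then show "B\<^sup>T $$ (i, j) = B $$ (i, j)"
      using sym[of i "j + n"] by (auto simp: B_def flip_sign_def flip_def)
  qed (auto simp: B_def)
  moreover have "C\<^sup>T = - C"
  proof (rule eq_matI)
    fix i j assume "i < dim_row (- C)" "j < dim_col (- C)"
    then show "C\<^sup>T $$ (i, j) = (- C) $$ (i, j)"
      using sym[of "i + n" j] by (auto simp: C_def flip_sign_def flip_def)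
  qed (auto simp: C_def)
  moreover have "A \<in> carrier_mat n n" "B \<in> carrier_mat n n" "C \<in> carrier_mat n n"
    by (auto simp: A_def B_def C_def)
  ultimately show ?L unfolding periplectic_def by blast
qed

lemma periplectic_carrier: "X \<in> periplectic n \<Longrightarrow> X \<in> carrier_mat (2 * n) (2 * n)"
  unfolding periplectic_iff by blast

lemma periplectic_dim: "X \<in> periplectic n \<Longrightarrow> dim_row X = 2 * n \<and> dim_col X = 2 * n"
  using periplectic_carrier by blast

lemma periplectic_sym:
  "X \<in> periplectic n \<Longrightarrow> a < 2 * n \<Longrightarrow> b < 2 * n \<Longrightarrow>
     X $$ (a, b) = flip_sign n a b * X $$ (flip n b, flip n a)"
  unfolding periplectic_iff by blast

lemma periplecticI:
  assumes "X \<in> carrier_mat (2 * n) (2 * n)"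
    and "\<And>a b. a < 2 * n \<Longrightarrow> b < 2 * n \<Longrightarrow>
      X $$ (a, b) = flip_sign n a b * X $$ (flip n b, flip n a)"
  shows "X \<in> periplectic n"
  using assms unfolding periplectic_iff by blast

section \<open>Truncations and root vectors\<close>

definition restrict_entries :: "nat \<Rightarrow> (nat \<Rightarrow> nat \<Rightarrow> bool) \<Rightarrow> complex mat \<Rightarrow> complex mat" where
  "restrict_entries n P X = mat (2*n) (2*n) (\<lambda>(a, b). if P a b then X $$ (a, b) else 0)"

text \<open>Truncation to a set of entries closed under the mirror splits an element into components
  inside the algebra.\<close>

lemma restrict_entries_periplectic:
  assumes "X \<in> periplectic n"
    and "\<And>a b. a < 2*n \<Longrightarrow> b < 2*n \<Longrightarrow> P (flip n b) (flip n a) \<longleftrightarrow> P a b"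
  shows "restrict_entries n P X \<in> periplectic n"
proof (rule periplecticI)
  fix a b assume ab: "a < 2*n" "b < 2*n"
  show "restrict_entries n P X $$ (a, b)
      = flip_sign n a b * restrict_entries n P X $$ (flip n b, flip n a)"
    using ab assms(2)[OF ab] periplectic_sym[OF assms(1) ab]
    by (simp add: restrict_entries_def flip_less)
qed (simp add: restrict_entries_def)

text \<open>E_ab made invariant under the mirror. At a self-mirrored entry the two terms meet,
  giving 2 in the symmetric block and 0 in the skew one. For a = b < n this is a basis element of
  the Cartan subalgebra.\<close>

definition root_matrix :: "nat \<Rightarrow> nat \<Rightarrow> nat \<Rightarrow> complex mat" where
  "root_matrix n a b = mat (2*n) (2*n) (\<lambda>(c, d).
     of_bool (c = a \<and> d = b) + of_bool (c = flip n b \<and> d = flip n a) * flip_sign n a b)"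

lemma root_matrix_periplectic:
  assumes ab: "a < 2*n" "b < 2*n"
  shows "root_matrix n a b \<in> periplectic n"
proof (rule periplecticI)
  fix c d assume cd: "c < 2*n" "d < 2*n"
  define P where "P \<longleftrightarrow> c = a \<and> d = b"
  define Q where "Q \<longleftrightarrow> c = flip n b \<and> d = flip n a"
  have e: "flip n d = a \<longleftrightarrow> d = flip n a" "flip n c = b \<longleftrightarrow> c = flip n b"
    "flip n d = flip n b \<longleftrightarrow> d = b" "flip n c = flip n a \<longleftrightarrow> c = a"
    using ab cd by (auto simp: flip_def split: if_splits)
  have "root_matrix n a b $$ (c, d) = of_bool P + of_bool Q * flip_sign n a b"
    using cd by (simp add: root_matrix_def P_def Q_def)
  \<comment> \<open>Mirroring exchanges the two terms, so what remains is that the sign squares to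
    1.\<close>
  moreover have "root_matrix n a b $$ (flip n d, flip n c) = of_bool Q + of_bool P * flip_sign n a b"
    using cd by (simp add: root_matrix_def P_def Q_def e flip_less conj_commute)
  moreover have "flip_sign n c d = flip_sign n a b" if "P \<or> Q"
    using that ab flip_sign_flip unfolding P_def Q_def by blast
  ultimately show "root_matrix n a b $$ (c, d)
      = flip_sign n c d * root_matrix n a b $$ (flip n d, flip n c)"
    by (cases P; cases Q) (simp_all add: flip_sign_square distrib_left)
qed (simp add: root_matrix_def)

lemma root_matrix_support:
  assumes "a < 2*n" "b < 2*n" "c < 2*n" "d < 2*n" "root_matrix n a b $$ (c, d) \<noteq> 0"
  shows "c = a \<and> d = b \<or> c = flip n b \<and> d = flip n a"
proof (rule ccontr)
  assume "\<not> ?thesis"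
  then have "\<not> (c = a \<and> d = b)" "\<not> (c = flip n b \<and> d = flip n a)" by blast+
  with assms show False by (simp add: root_matrix_def)
qed

text \<open>The excluded entries would have weight \<open>-2\<epsilon>\<close>; they are the diagonal entries of the
  skew-symmetric block.\<close>

definition allowed :: "nat \<Rightarrow> nat \<Rightarrow> nat \<Rightarrow> bool" where
  "allowed n a b \<longleftrightarrow> a < 2*n \<and> b < 2*n \<and> \<not> (n \<le> a \<and> b = flip n a)"

text \<open>The two terms can interfere only at a self-mirrored entry; an allowed one lies in the
  symmetric block, where they add up to 2.\<close>

lemma root_matrix_nonzero:
  assumes "allowed n a b" shows "root_matrix n a b $$ (a, b) \<noteq> 0"
proof -
  define Q where "Q \<longleftrightarrow> a = flip n b \<and> b = flip n a"
  have "root_matrix n a b $$ (a, b) = 1 + of_bool Q * flip_sign n a b"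
    using assms by (simp add: allowed_def root_matrix_def Q_def)
  moreover have "flip_sign n a b = 1" if Q
  proof -
    have b: "b = flip n a" using that unfolding Q_def by blast
    then have "a < n" using assms unfolding allowed_def by (meson not_less)
    then show ?thesis unfolding b by (simp add: flip_sign_def flip_def)
  qed
  ultimately show ?thesis by (cases Q) simp_all
qed

text \<open>At an excluded entry the mirror equation reads x = -x.\<close>

lemma periplectic_allowed:
  assumes "X \<in> periplectic n" "a < 2*n" "b < 2*n" "X $$ (a, b) \<noteq> 0"
  shows "allowed n a b"
proof (rule ccontr)
  assume "\<not> allowed n a b"
  then have "n \<le> a" "b = flip n a" using assms by (auto simp: allowed_def)
  moreover have "X $$ (a, b) = flip_sign n a b * X $$ (flip n b, flip n a)"
    using assms periplectic_sym by blast
  ultimately show False using assms by (simp add: flip_flip flip_sign_def)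
qed

section \<open>Even part, Cartan subalgebra and even Borel subalgebra by their supports\<close>

lemma periplectic_even_iff:
  "X \<in> periplectic_even n \<longleftrightarrow> X \<in> periplectic n \<and>
     (\<forall>a<2*n. \<forall>b<2*n. X $$ (a, b) \<noteq> 0 \<longrightarrow> (a < n \<longleftrightarrow> b < n))"
  (is "?L \<longleftrightarrow> ?R")
proof
  assume ?L
  then obtain A where A: "A \<in> carrier_mat n n"
    and X: "X = four_block_mat A (0\<^sub>m n n) (0\<^sub>m n n) (- A\<^sup>T)"
    unfolding periplectic_even_def by blast
  have t: "(0\<^sub>m n n :: complex mat)\<^sup>T = 0\<^sub>m n n" "(0\<^sub>m n n :: complex mat)\<^sup>T = - 0\<^sub>m n n"
    by (rule eq_matI; simp)+
  have "X \<in> periplectic n"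
    unfolding periplectic_def mem_Collect_eq using A X t zero_carrier_mat by blast
  then show ?R using A by (auto simp: X)
next
  assume R: ?R
  then obtain A B C where X: "X = four_block_mat A B C (- A\<^sup>T)"
    and A: "A \<in> carrier_mat n n" and B: "B \<in> carrier_mat n n" and C: "C \<in> carrier_mat n n"
    unfolding periplectic_def by blast
  have "B = 0\<^sub>m n n"
  proof (rule eq_matI)
    fix i j assume "i < dim_row (0\<^sub>m n n :: complex mat)" "j < dim_col (0\<^sub>m n n :: complex mat)"
    then have ij: "i < n" "j < n" by auto
    have "X $$ (i, j + n) = 0" using R[THEN conjunct2, rule_format, of i "j + n"] ij by auto
    then show "B $$ (i, j) = 0\<^sub>m n n $$ (i, j)" using ij A B C by (auto simp: X)
  qed (use B in auto)
  moreover have "C = 0\<^sub>m n n"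
  proof (rule eq_matI)
    fix i j assume "i < dim_row (0\<^sub>m n n :: complex mat)" "j < dim_col (0\<^sub>m n n :: complex mat)"
    then have ij: "i < n" "j < n" by auto
    have "X $$ (i + n, j) = 0" using R[THEN conjunct2, rule_format, of "i + n" j] ij by auto
    then show "C $$ (i, j) = 0\<^sub>m n n $$ (i, j)" using ij A B C by (auto simp: X)
  qed (use C in auto)
  ultimately show ?L using A X unfolding periplectic_even_def by blast
qed

lemma cartan_iff:
  "X \<in> cartan n \<longleftrightarrow> X \<in> periplectic n \<and> (\<forall>a<2*n. \<forall>b<2*n. X $$ (a, b) \<noteq> 0 \<longrightarrow> a = b)"
proof (cases "X \<in> periplectic n")
  case True
  then have d: "dim_row X = 2 * n" "dim_col X = 2 * n" by (auto dest: periplectic_dim)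
  show ?thesis using True unfolding cartan_def diagonal_mat_def mem_Collect_eq d by blast
qed (simp add: cartan_def)

lemma std_even_borel_iff:
  "X \<in> std_even_borel n \<longleftrightarrow> X \<in> periplectic_even n \<and>
     (\<forall>a<n. \<forall>b<n. X $$ (a, b) \<noteq> 0 \<longrightarrow> a \<le> b)"
proof -
  have "upper_triangular A \<longleftrightarrow>
      (\<forall>a<n. \<forall>b<n. four_block_mat A (0\<^sub>m n n) (0\<^sub>m n n) (- A\<^sup>T) $$ (a, b) \<noteq> 0 \<longrightarrow> a \<le> b)"
    if "A \<in> carrier_mat n n" for A :: "complex mat"
  proof -
    have d: "dim_row A = n" using that by simp
    have "four_block_mat A (0\<^sub>m n n) (0\<^sub>m n n) (- A\<^sup>T) $$ (a, b) = A $$ (a, b)"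
      if "a < n" "b < n" for a b
      using that \<open>A \<in> carrier_mat n n\<close> by simp
    moreover have "upper_triangular A \<longleftrightarrow> (\<forall>a<n. \<forall>b<n. A $$ (a, b) \<noteq> 0 \<longrightarrow> a \<le> b)"
      unfolding upper_triangular_def d by (meson less_trans not_less)
    ultimately show ?thesis by simp
  qed
  then show ?thesis
    unfolding std_even_borel_def periplectic_even_def by blast
qed

section \<open>Weights of matrix entries and root spaces\<close>

definition entry_weight :: "nat \<Rightarrow> nat \<Rightarrow> nat \<Rightarrow> complex vec" where
  "entry_weight n a b = vec n (\<lambda>k. (if a = k then 1 else 0) - (if a = k + n then 1 else 0)
     - (if b = k then 1 else 0) + (if b = k + n then 1 else 0))"

lemma entry_weight_carrier: "entry_weight n a b \<in> carrier_vec n"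
  by (simp add: entry_weight_def)

text \<open>With the convention \<epsilon>_{i+n} = -\<epsilon>_i the weight of (a, b) is
  \<epsilon>_a - \<epsilon>_b, and \<open>flip\<close> negates each \<epsilon>.\<close>

lemma entry_weight_flip:
  assumes "a < 2*n" "b < 2*n"
  shows "entry_weight n (flip n b) (flip n a) = entry_weight n a b"
  by (rule eq_vecI) (use assms in \<open>auto simp: entry_weight_def flip_def\<close>)

lemma sum_mult_delta:
  fixes f :: "nat \<Rightarrow> complex"
  shows "(\<Sum>k<n. f k * (if a = k then 1 else 0)) = (if a < n then f a else 0)"
    and "(\<Sum>k<n. f k * (if a = k + n then 1 else 0)) = (if n \<le> a \<and> a < 2 * n then f (a - n) else 0)"
proof -
  show "(\<Sum>k<n. f k * (if a = k then 1 else 0)) = (if a < n then f a else 0)"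
    by (simp add: if_distrib cong: if_cong)
  show "(\<Sum>k<n. f k * (if a = k + n then 1 else 0)) = (if n \<le> a \<and> a < 2 * n then f (a - n) else 0)"
  proof (cases "n \<le> a")
    case True
    have "(\<Sum>k<n. f k * (if a = k + n then 1 else 0)) = (\<Sum>k<n. f k * (if a - n = k then 1 else 0))"
      using True by (intro sum.cong) auto
    also have "\<dots> = (if a - n < n then f (a - n) else 0)"
      by (simp add: if_distrib cong: if_cong)
    finally show ?thesis using True by auto
  qed (auto intro!: sum.neutral)
qed

text \<open>Extending f by f(k + n) = -f(k), the pairing is f(a) - f(b). It serves for the diagonal
  of a Cartan element and for the coordinates of \<delta>.\<close>

lemma sum_mult_entry_weight:
  assumes "a < 2*n" "b < 2*n"
  shows "(\<Sum>k<n. f k * entry_weight n a b $ k) =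
    (if a < n then f a else - f (a - n)) - (if b < n then f b else - f (b - n))"
proof -
  have "(\<Sum>k<n. f k * entry_weight n a b $ k) =
     (\<Sum>k<n. f k * (if a = k then 1 else 0)) - (\<Sum>k<n. f k * (if a = k + n then 1 else 0))
     - (\<Sum>k<n. f k * (if b = k then 1 else 0)) + (\<Sum>k<n. f k * (if b = k + n then 1 else 0))"
    unfolding sum_subtractf[symmetric] sum.distrib[symmetric]
    by (intro sum.cong) (auto simp: entry_weight_def)
  then show ?thesis using assms unfolding sum_mult_delta by auto
qed

lemma cartan_entries:
  assumes "H \<in> cartan n" "a < n"
  shows "H $$ (a + n, a + n) = - H $$ (a, a)"
proof -
  have "H $$ (a + n, a + n) = flip_sign n (a + n) (a + n) * H $$ (flip n (a + n), flip n (a + n))"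
    using assms unfolding cartan_iff by (intro periplectic_sym) auto
  then show ?thesis using assms by (simp add: flip_def flip_sign_def)
qed

lemma weight_eval_entry_weight:
  assumes "H \<in> cartan n" "a < 2*n" "b < 2*n"
  shows "weight_eval n (entry_weight n a b) H = H $$ (a, a) - H $$ (b, b)"
proof -
  have *: "H $$ (c, c) = (if c < n then H $$ (c, c) else - H $$ (c - n, c - n))" if "c < 2*n" for c
    using cartan_entries[OF assms(1), of "c - n"] that by auto
  have "weight_eval n (entry_weight n a b) H = (\<Sum>k<n. H $$ (k, k) * entry_weight n a b $ k)"
    by (simp add: weight_eval_def mult.commute)
  then show ?thesis
    unfolding sum_mult_entry_weight[OF assms(2,3)] using *[of a] *[of b] assms by auto
qed

text \<open>A diagonal H is even, so the supercommutator is the ordinary commutator and scales each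
  entry separately.\<close>

lemma supercommutator_cartan:
  assumes H: "H \<in> cartan n" and X: "X \<in> carrier_mat (2*n) (2*n)" and ab: "a < 2*n" "b < 2*n"
  shows "supercommutator n H X $$ (a, b) = (H $$ (a, a) - H $$ (b, b)) * X $$ (a, b)"
proof -
  have Hc: "H \<in> carrier_mat (2*n) (2*n)"
    and diag: "\<And>a b. a < 2*n \<Longrightarrow> b < 2*n \<Longrightarrow> a \<noteq> b \<Longrightarrow> H $$ (a, b) = 0"
    using H by (auto simp: cartan_iff periplectic_carrier)
  have e: "even_part n H = H"
    by (rule eq_matI) (use Hc diag in \<open>auto simp: even_part_def\<close>)
  have o: "odd_part n H = 0\<^sub>m (2*n) (2*n)"
    by (rule eq_matI) (use Hc diag in \<open>auto simp: odd_part_def\<close>)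
  have c: "even_part n X \<in> carrier_mat (2*n) (2*n)" "odd_part n X \<in> carrier_mat (2*n) (2*n)"
    by (auto simp: even_part_def odd_part_def)
  have "(H * X) $$ (a, b) = (\<Sum>k\<in>{0..<2*n}. H $$ (a, k) * X $$ (k, b))"
    using Hc X ab by (simp add: scalar_prod_def)
  also have "\<dots> = (\<Sum>k\<in>{0..<2*n}. if k = a then H $$ (a, a) * X $$ (a, b) else 0)"
    using diag ab by (intro sum.cong) auto
  finally have l: "(H * X) $$ (a, b) = H $$ (a, a) * X $$ (a, b)"
    using ab by simp
  have r: "(Y * H) $$ (a, b) = Y $$ (a, b) * H $$ (b, b)" if Y: "Y \<in> carrier_mat (2*n) (2*n)" for Y
  proof -
    have "(Y * H) $$ (a, b) = (\<Sum>k\<in>{0..<2*n}. Y $$ (a, k) * H $$ (k, b))"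
      using Hc Y ab by (simp add: scalar_prod_def)
    also have "\<dots> = (\<Sum>k\<in>{0..<2*n}. if k = b then Y $$ (a, b) * H $$ (b, b) else 0)"
      using diag ab by (intro sum.cong) auto
    finally show ?thesis using ab by simp
  qed
  have "X $$ (a, b) = even_part n X $$ (a, b) + odd_part n X $$ (a, b)"
    using ab by (auto simp: even_part_def odd_part_def)
  then show ?thesis
    unfolding supercommutator_def e o
    using c Hc X ab by (simp add: l r algebra_simps del: index_mult_mat(1))
qed

text \<open>The bracket with H does not mix entries, so a joint eigenvector is supported where the
  entry weight is the eigenvalue.\<close>

lemma root_space_iff:
  assumes \<alpha>: "\<alpha> \<in> carrier_vec n"
  shows "X \<in> root_space n \<alpha> \<longleftrightarrow> X \<in> periplectic n \<and>
     (\<forall>a<2*n. \<forall>b<2*n. X $$ (a, b) \<noteq> 0 \<longrightarrow> entry_weight n a b = \<alpha>)"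
  (is "?L \<longleftrightarrow> ?R")
proof
  assume L: ?L
  then have X: "X \<in> periplectic n"
    and br: "\<And>H. H \<in> cartan n \<Longrightarrow> supercommutator n H X = weight_eval n \<alpha> H \<cdot>\<^sub>m X"
    by (auto simp: root_space_def)
  from X have Xc: "X \<in> carrier_mat (2*n) (2*n)" by (simp add: periplectic_carrier)
  have "entry_weight n a b = \<alpha>" if ab: "a < 2*n" "b < 2*n" and nz: "X $$ (a, b) \<noteq> 0" for a b
  proof (rule eq_vecI)
    fix k assume "k < dim_vec \<alpha>"
    then have k: "k < n" using \<alpha> by auto
    \<comment> \<open>The basis element of the Cartan subalgebra dual to \<epsilon>_k; evaluating a
      weight on it reads off coordinate k.\<close>
    define H where "H = root_matrix n k k"
    have H: "H \<in> cartan n"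
      using k root_matrix_periplectic[of k n k] root_matrix_support[of k n k]
      by (fastforce simp: cartan_iff H_def flip_def)
    have Hkk: "H $$ (i, i) = (if i = k then 1 else 0)" if "i < n" for i
      using that k by (auto simp: H_def root_matrix_def flip_def)
    have w: "weight_eval n v H = v $ k" for v
      using k by (simp add: weight_eval_def Hkk if_distrib cong: if_cong)
    have "(H $$ (a, a) - H $$ (b, b)) * X $$ (a, b) = weight_eval n \<alpha> H * X $$ (a, b)"
      using supercommutator_cartan[OF H Xc ab] br[OF H] Xc ab by auto
    then show "entry_weight n a b $ k = \<alpha> $ k"
      using nz weight_eval_entry_weight[OF H ab] unfolding w by simp
  qed (use \<alpha> entry_weight_carrier[of n a b] in auto)
  then show ?R using X by blast
next
  assume R: ?R
  then have Xc: "X \<in> carrier_mat (2*n) (2*n)" by (simp add: periplectic_carrier)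
  have "supercommutator n H X = weight_eval n \<alpha> H \<cdot>\<^sub>m X" if H: "H \<in> cartan n" for H
  proof (rule eq_matI)
    fix a b assume "a < dim_row (weight_eval n \<alpha> H \<cdot>\<^sub>m X)" "b < dim_col (weight_eval n \<alpha> H \<cdot>\<^sub>m X)"
    then have ab: "a < 2*n" "b < 2*n" using Xc by auto
    show "supercommutator n H X $$ (a, b) = (weight_eval n \<alpha> H \<cdot>\<^sub>m X) $$ (a, b)"
    proof (cases "X $$ (a, b) = 0")
      case False
      then have "entry_weight n a b = \<alpha>" using R ab by blast
      then show ?thesis
        using supercommutator_cartan[OF H Xc ab] weight_eval_entry_weight[OF H ab] Xc ab by simp
    qed (use supercommutator_cartan[OF H Xc ab] Xc ab in simp)
  qed (use Xc H in \<open>auto simp: supercommutator_def odd_part_def\<close>)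
  then show ?L using R by (auto simp: root_space_def)
qed

text \<open>Each entry has a single weight, so at most one summand is nonzero there and the sum is
  described by its support.\<close>

lemma root_space_sum_iff:
  assumes fin: "finite S" and S: "S \<subseteq> carrier_vec n"
  shows "X \<in> root_space_sum n S \<longleftrightarrow> X \<in> periplectic n \<and>
     (\<forall>a<2*n. \<forall>b<2*n. X $$ (a, b) \<noteq> 0 \<longrightarrow> entry_weight n a b \<in> S)"
  (is "?L \<longleftrightarrow> ?R")
proof
  assume ?L
  then obtain Y where X: "X = mat (2*n) (2*n) (\<lambda>ij. \<Sum>\<alpha>\<in>S. Y \<alpha> $$ ij)"
    and Y: "\<And>\<alpha>. \<alpha> \<in> S \<Longrightarrow> Y \<alpha> \<in> root_space n \<alpha>"
    unfolding root_space_sum_def by auto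
  have Yp: "Y \<alpha> \<in> periplectic n" if "\<alpha> \<in> S" for \<alpha>
    using Y[OF that] by (simp add: root_space_def)
  have "X \<in> periplectic n"
  proof (rule periplecticI)
    fix a b assume ab: "a < 2*n" "b < 2*n"
    have "(\<Sum>\<alpha>\<in>S. Y \<alpha> $$ (a, b)) = (\<Sum>\<alpha>\<in>S. flip_sign n a b * Y \<alpha> $$ (flip n b, flip n a))"
      using Yp ab by (intro sum.cong) (auto intro: periplectic_sym)
    then show "X $$ (a, b) = flip_sign n a b * X $$ (flip n b, flip n a)"
      using ab by (simp add: X flip_less sum_distrib_left)
  qed (simp add: X)
  moreover have "entry_weight n a b \<in> S" if ab: "a < 2*n" "b < 2*n" and "X $$ (a, b) \<noteq> 0" for a b
  proof -
    have "(\<Sum>\<alpha>\<in>S. Y \<alpha> $$ (a, b)) \<noteq> 0" using that by (simp add: X)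
    then obtain \<alpha> where "\<alpha> \<in> S" "Y \<alpha> $$ (a, b) \<noteq> 0" by (meson sum.neutral)
    then show ?thesis using Y S ab root_space_iff[of \<alpha> n "Y \<alpha>"] by auto
  qed
  ultimately show ?R by blast
next
  assume R: ?R
  \<comment> \<open>The component of weight \<alpha>; it stays in the algebra because mirror entries
    have equal weights.\<close>
  define Y where "Y \<alpha> = restrict_entries n (\<lambda>a b. entry_weight n a b = \<alpha>) X" for \<alpha>
  have "X = mat (2*n) (2*n) (\<lambda>ij. \<Sum>\<alpha>\<in>S. Y \<alpha> $$ ij)"
  proof (rule eq_matI, goal_cases)
    case (1 a b)
    then have ab: "a < 2*n" "b < 2*n" by auto
    have "(\<Sum>\<alpha>\<in>S. Y \<alpha> $$ (a, b)) = (\<Sum>\<alpha>\<in>S. if entry_weight n a b = \<alpha> then X $$ (a, b) else 0)"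
      using ab by (simp add: Y_def restrict_entries_def)
    also have "\<dots> = X $$ (a, b)" using R ab fin by auto
    finally show ?case using ab by simp
  qed (use R periplectic_dim[of X n] in auto)
  moreover have "Y \<alpha> \<in> root_space n \<alpha>" if "\<alpha> \<in> S" for \<alpha>
  proof -
    have "Y \<alpha> \<in> periplectic n"
      unfolding Y_def using R by (intro restrict_entries_periplectic) (auto simp: entry_weight_flip)
    then show ?thesis
      using that S by (subst root_space_iff) (auto simp: Y_def restrict_entries_def)
  qed
  ultimately show ?L unfolding root_space_sum_def by blast
qed

lemma finite_roots: "finite (roots n)"
proof -
  have "roots n \<subseteq> (\<lambda>(i, j). unit_vec n i - unit_vec n j) ` ({..<n} \<times> {..<n})
      \<union> (\<lambda>(i, j). unit_vec n i + unit_vec n j) ` ({..<n} \<times> {..<n})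
      \<union> (\<lambda>(i, j). - unit_vec n i - unit_vec n j) ` ({..<n} \<times> {..<n})"
    unfolding roots_def by (fastforce intro: rev_image_eqI)
  then show ?thesis by (rule finite_subset) auto
qed

lemma roots_carrier: "roots n \<union> {0\<^sub>v n} \<subseteq> carrier_vec n"
  by (auto simp: roots_def)

text \<open>Every entry that can be nonzero has a weight among those summed over, so restricting the
  sums to roots and 0 costs nothing at the level of entries.\<close>

lemma entry_weight_root:
  assumes "allowed n a b"
  shows "entry_weight n a b \<in> roots n \<union> {0\<^sub>v n}"
proof -
  have lt: "a < 2*n" "b < 2*n" using assms by (auto simp: allowed_def)
  have diff: "unit_vec n i - unit_vec n j \<in> roots n \<union> {0\<^sub>v n}" if "i < n" "j < n" for i j
  proof (cases "i = j")
    case True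
    then have "unit_vec n i - unit_vec n j = (0\<^sub>v n :: complex vec)" by simp
    then show ?thesis by simp
  next
    case False
    then have "unit_vec n i - unit_vec n j
        \<in> {unit_vec n i - unit_vec n j :: complex vec | i j. i < n \<and> j < n \<and> i \<noteq> j}"
      using that by (intro CollectI exI[of _ i] exI[of _ j]) simp
    then show ?thesis unfolding roots_def by (intro UnI1)
  qed
  consider (A) "a < n" "b < n" | (B) "a < n" "n \<le> b" | (C) "n \<le> a" "b < n" | (D) "n \<le> a" "n \<le> b"
    by linarith
  then show ?thesis
  proof cases
    case A
    have "entry_weight n a b = unit_vec n a - unit_vec n b"
      by (rule eq_vecI) (use A in \<open>auto simp: entry_weight_def unit_vec_def\<close>)
    then show ?thesis using diff A by simp
  next
    case B
    \<comment> \<open>Roots are listed with ordered indices, whereas the row may come before or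
      after the column.\<close>
    have e: "entry_weight n a b = unit_vec n (min a (b - n)) + unit_vec n (max a (b - n))"
      by (rule eq_vecI) (use B lt in \<open>auto simp: entry_weight_def unit_vec_def min_def max_def\<close>)
    have "min a (b - n) \<le> max a (b - n)" "max a (b - n) < n" using B lt by auto
    then have "entry_weight n a b \<in> {unit_vec n i + unit_vec n j | i j. i \<le> j \<and> j < n}"
      unfolding e by (intro CollectI exI conjI) (rule refl)
    then show ?thesis unfolding roots_def by (rule UnI1[OF UnI1[OF UnI2]])
  next
    case C
    then have ne: "a - n \<noteq> b" using assms by (auto simp: allowed_def flip_def)
    have e: "entry_weight n a b = - unit_vec n (min (a - n) b) - unit_vec n (max (a - n) b)"
      by (rule eq_vecI) (use C lt in \<open>auto simp: entry_weight_def unit_vec_def min_def max_def\<close>)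
    have "min (a - n) b < max (a - n) b" "max (a - n) b < n" using ne C lt by auto
    then have "entry_weight n a b \<in> {- unit_vec n i - unit_vec n j | i j. i < j \<and> j < n}"
      unfolding e by (intro CollectI exI conjI) (rule refl)
    then show ?thesis unfolding roots_def by (rule UnI1[OF UnI2])
  next
    case D
    have "entry_weight n a b = unit_vec n (b - n) - unit_vec n (a - n)"
      by (rule eq_vecI) (use D lt in \<open>auto simp: entry_weight_def unit_vec_def\<close>)
    moreover have "a - n < n" "b - n < n" using D lt by auto
    ultimately show ?thesis using diff by simp
  qed
qed

section \<open>Levi and parabolic subalgebras by signed coordinates\<close>

definition signed :: "nat \<Rightarrow> (nat \<Rightarrow> real) \<Rightarrow> nat \<Rightarrow> real" where
  "signed n d a = (if a < n then d a else - d (a - n))"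

lemma signed_flip: "a < 2*n \<Longrightarrow> signed n d (flip n a) = - signed n d a"
  by (auto simp: signed_def flip_def)

definition re_coords :: "complex vec \<Rightarrow> nat \<Rightarrow> real" where
  "re_coords \<delta> k = Re (\<delta> $ k)"

lemma Re_scalar_prod_entry_weight:
  assumes "a < 2*n" "b < 2*n"
  shows "Re (scalar_prod \<delta> (entry_weight n a b))
    = signed n (re_coords \<delta>) a - signed n (re_coords \<delta>) b"
proof -
  have "scalar_prod \<delta> (entry_weight n a b) = (\<Sum>k<n. \<delta> $ k * entry_weight n a b $ k)"
    using entry_weight_carrier[of n a b] by (simp add: scalar_prod_def lessThan_atLeast0)
  then show ?thesis
    unfolding sum_mult_entry_weight[OF assms] by (auto simp: signed_def re_coords_def)
qed

text \<open>The predicate P is kept general so that the Levi subalgebra (= 0) and the nilradical (>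
  0) are both instances.\<close>

lemma root_space_sum_roots_iff:
  assumes S: "S = {\<alpha> \<in> roots n \<union> {0\<^sub>v n}. P (Re (scalar_prod \<delta> \<alpha>))}"
  shows "X \<in> root_space_sum n S \<longleftrightarrow> X \<in> periplectic n \<and>
    (\<forall>a<2*n. \<forall>b<2*n. X $$ (a, b) \<noteq> 0 \<longrightarrow>
       P (signed n (re_coords \<delta>) a - signed n (re_coords \<delta>) b))"
proof -
  have "finite S" "S \<subseteq> carrier_vec n"
    unfolding S using finite_roots[of n] roots_carrier[of n] by auto
  moreover have "entry_weight n a b \<in> S \<longleftrightarrow> P (signed n (re_coords \<delta>) a - signed n (re_coords \<delta>) b)"
    if "X \<in> periplectic n" "a < 2*n" "b < 2*n" "X $$ (a, b) \<noteq> 0" for a b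
    using entry_weight_root[OF periplectic_allowed[OF that]]
      Re_scalar_prod_entry_weight[of a n b \<delta>] that(2,3) unfolding S by simp
  ultimately show ?thesis by (subst root_space_sum_iff) blast+
qed

lemma levi_iff:
  "X \<in> levi n \<delta> \<longleftrightarrow> X \<in> periplectic n \<and>
    (\<forall>a<2*n. \<forall>b<2*n. X $$ (a, b) \<noteq> 0 \<longrightarrow>
       signed n (re_coords \<delta>) a = signed n (re_coords \<delta>) b)"
  unfolding levi_def by (subst root_space_sum_roots_iff[OF refl]) simp

lemma nilrad_plus_iff:
  "X \<in> nilrad_plus n \<delta> \<longleftrightarrow> X \<in> periplectic n \<and>
    (\<forall>a<2*n. \<forall>b<2*n. X $$ (a, b) \<noteq> 0 \<longrightarrow>
       signed n (re_coords \<delta>) a > signed n (re_coords \<delta>) b)"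
  unfolding nilrad_plus_def by (subst root_space_sum_roots_iff[OF refl]) simp

lemma parabolic_iff:
  "X \<in> parabolic n \<delta> \<longleftrightarrow> X \<in> periplectic n \<and>
    (\<forall>a<2*n. \<forall>b<2*n. X $$ (a, b) \<noteq> 0 \<longrightarrow>
       signed n (re_coords \<delta>) a \<ge> signed n (re_coords \<delta>) b)"
  (is "?L \<longleftrightarrow> ?R")
proof
  let ?s = "signed n (re_coords \<delta>)"
  {
    assume ?L
    then obtain Y Z where X: "X = Y + Z" and Y: "Y \<in> levi n \<delta>" and Z: "Z \<in> nilrad_plus n \<delta>"
      unfolding parabolic_def by blast
    have c: "Y \<in> carrier_mat (2*n) (2*n)" "Z \<in> carrier_mat (2*n) (2*n)"
      using Y Z by (auto simp: levi_iff nilrad_plus_iff periplectic_carrier)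
    have "X \<in> periplectic n"
    proof (rule periplecticI)
      fix a b assume ab: "a < 2*n" "b < 2*n"
      show "X $$ (a, b) = flip_sign n a b * X $$ (flip n b, flip n a)"
        using ab c periplectic_sym[of Y n a b] periplectic_sym[of Z n a b] Y Z
        by (simp add: X levi_iff nilrad_plus_iff flip_less distrib_left)
    qed (use c in \<open>simp add: X\<close>)
    moreover have "?s a \<ge> ?s b" if "a < 2*n" "b < 2*n" "X $$ (a, b) \<noteq> 0" for a b
    proof -
      have "Y $$ (a, b) \<noteq> 0 \<or> Z $$ (a, b) \<noteq> 0" using that c by (auto simp: X)
      then show ?thesis using Y Z that unfolding levi_iff nilrad_plus_iff by force
    qed
    ultimately show ?R by blast
  }
  {
    assume R: ?R
    define Y where "Y = restrict_entries n (\<lambda>a b. ?s a = ?s b) X"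
    \<comment> \<open>For X as in the right-hand side, unequal signed values at a nonzero entry are
      strictly decreasing from row to column, so this is the nilradical component.\<close>
    define Z where "Z = restrict_entries n (\<lambda>a b. ?s a \<noteq> ?s b) X"
    have "X = Y + Z"
      by (rule eq_matI) (use R periplectic_dim[of X n] in \<open>auto simp: Y_def Z_def restrict_entries_def\<close>)
    moreover have "Y \<in> periplectic n" "Z \<in> periplectic n"
      unfolding Y_def Z_def using R by (auto intro!: restrict_entries_periplectic simp: signed_flip)
    then have "Y \<in> levi n \<delta>" "Z \<in> nilrad_plus n \<delta>"
      using R unfolding levi_iff nilrad_plus_iff
      by (auto simp: Y_def Z_def restrict_entries_def less_le split: if_splits)
    ultimately show ?L unfolding parabolic_def by blast
  }
qed

text \<open>Root matrices test the inclusion: the mirror entry imposes the same inequality, so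
  \<open>root_matrix n a b\<close> lies in a parabolic subalgebra exactly when (a, b) satisfies
  it.\<close>

lemma parabolic_subset_iff:
  "parabolic n \<delta> \<subseteq> parabolic n \<delta>' \<longleftrightarrow> (\<forall>a b. allowed n a b \<longrightarrow>
     signed n (re_coords \<delta>) a \<ge> signed n (re_coords \<delta>) b \<longrightarrow>
     signed n (re_coords \<delta>') a \<ge> signed n (re_coords \<delta>') b)"
  (is "?L \<longleftrightarrow> ?R")
proof
  assume L: ?L
  show ?R
  proof (intro allI impI)
    fix a b assume al: "allowed n a b"
      and ge: "signed n (re_coords \<delta>) a \<ge> signed n (re_coords \<delta>) b"
    have ab: "a < 2*n" "b < 2*n" using al by (auto simp: allowed_def)
    have "signed n (re_coords \<delta>) c \<ge> signed n (re_coords \<delta>) d"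
      if "c < 2*n" "d < 2*n" "root_matrix n a b $$ (c, d) \<noteq> 0" for c d
      using root_matrix_support[OF ab that] ge signed_flip[OF ab(1), of "re_coords \<delta>"]
        signed_flip[OF ab(2), of "re_coords \<delta>"] by (elim disjE conjE; simp)
    then have "root_matrix n a b \<in> parabolic n \<delta>"
      unfolding parabolic_iff using root_matrix_periplectic[OF ab] by blast
    then have "root_matrix n a b \<in> parabolic n \<delta>'" using L by blast
    then show "signed n (re_coords \<delta>') a \<ge> signed n (re_coords \<delta>') b"
      by (rule parabolic_iff[THEN iffD1, THEN conjunct2, rule_format])
        (use ab root_matrix_nonzero[OF al] in auto)
  qed
next
  assume R: ?R
  show ?L
  proof
    fix X assume X: "X \<in> parabolic n \<delta>"
    then have Xp: "X \<in> periplectic n" by (simp add: parabolic_iff)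
    have "signed n (re_coords \<delta>') a \<ge> signed n (re_coords \<delta>') b"
      if "a < 2*n" "b < 2*n" "X $$ (a, b) \<noteq> 0" for a b
      using R periplectic_allowed[OF Xp that]
        parabolic_iff[THEN iffD1, OF X, THEN conjunct2, rule_format, OF that] by simp
    then show "X \<in> parabolic n \<delta>'"
      unfolding parabolic_iff using Xp by simp
  qed
qed

subsection \<open>Integral representatives of signed orders\<close>

text \<open>Since the signed values include the negatives, comparing them records all signs of d_i -
  d_j, d_i + d_j and d_i. The classes are the faces of the type B hyperplane arrangement.\<close>

definition same_order :: "nat \<Rightarrow> (nat \<Rightarrow> real) \<Rightarrow> (nat \<Rightarrow> real) \<Rightarrow> bool" where
  "same_order n d d' \<longleftrightarrow> (\<forall>a<2*n. \<forall>b<2*n.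
     signed n d a \<le> signed n d b \<longleftrightarrow> signed n d' a \<le> signed n d' b)"

text \<open>Descending by ones from any nonzero absolute value ends at 1, so these values have no
  gaps; the bound 2 leaves open whether 0 occurs.\<close>

definition consecutive :: "nat \<Rightarrow> (nat \<Rightarrow> int) \<Rightarrow> bool" where
  "consecutive n z \<longleftrightarrow> (\<forall>i<n. 2 \<le> \<bar>z i\<bar> \<longrightarrow> (\<exists>j<n. \<bar>z j\<bar> = \<bar>z i\<bar> - 1))"

lemma same_order_sym: "same_order n d d' \<Longrightarrow> same_order n d' d"
  by (simp add: same_order_def)

lemma same_order_coords:
  assumes "same_order n d d'" "i < n" "j < n"
  shows "d i \<le> d j \<longleftrightarrow> d' i \<le> d' j" "d i \<le> - d j \<longleftrightarrow> d' i \<le> - d' j"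
    "- d i \<le> d j \<longleftrightarrow> - d' i \<le> d' j"
  using assms(1)[unfolded same_order_def, rule_format, of i j]
    assms(1)[unfolded same_order_def, rule_format, of i "j + n"]
    assms(1)[unfolded same_order_def, rule_format, of "i + n" j] assms(2,3)
  by (auto simp: signed_def)

lemma same_order_abs:
  assumes "same_order n d d'" "i < n" "j < n"
  shows "\<bar>d i\<bar> \<le> \<bar>d j\<bar> \<longleftrightarrow> \<bar>d' i\<bar> \<le> \<bar>d' j\<bar>"
proof -
  \<comment> \<open>The two disjuncts say that the absolute value of x is at most y, or at most -y;
    only signed comparisons are involved.\<close>
  have *: "\<bar>x\<bar> \<le> \<bar>y\<bar> \<longleftrightarrow> x \<le> y \<and> - x \<le> y \<or> x \<le> - y \<and> y \<le> x" for x y :: real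
    by linarith
  show ?thesis
    unfolding * using same_order_coords[OF assms] same_order_coords[OF assms(1,3,2)] by simp
qed

text \<open>A gap-free vector is minimal: below coordinate i sits some j with absolute value exactly
  one less, and in any integer vector z' of the same order that j lies at least one below i.\<close>

lemma consecutive_le:
  assumes z: "consecutive n z" and ord: "same_order n (\<lambda>i. of_int (z i)) (\<lambda>i. of_int (z' i))"
    and "i < n"
  shows "\<bar>z i\<bar> \<le> \<bar>z' i\<bar>"
  using \<open>i < n\<close>
proof (induction "nat \<bar>z i\<bar>" arbitrary: i rule: less_induct)
  case less
  have abs_iff: "\<bar>z i\<bar> \<le> \<bar>z j\<bar> \<longleftrightarrow> \<bar>z' i\<bar> \<le> \<bar>z' j\<bar>" if "j < n" for j
    using same_order_abs[OF ord less.prems that] by linarith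
  consider "z i = 0" | "\<bar>z i\<bar> = 1" | "2 \<le> \<bar>z i\<bar>" by linarith
  then show ?case
  proof cases
    case 2
    \<comment> \<open>Vanishing is visible in the order, as x = 0 means x \<le> -x and -x \<le>
      x.\<close>
    then have "z' i \<noteq> 0"
      using same_order_coords(2,3)[OF ord less.prems less.prems] by auto
    then show ?thesis using 2 by linarith
  next
    case 3
    then obtain j where j: "j < n" "\<bar>z j\<bar> = \<bar>z i\<bar> - 1"
      using z less.prems unfolding consecutive_def by blast
    then have "\<bar>z j\<bar> \<le> \<bar>z' j\<bar>" using less.hyps[of j] 3 by linarith
    moreover have "\<bar>z' j\<bar> < \<bar>z' i\<bar>" using abs_iff[OF j(1)] j(2) by linarith
    ultimately show ?thesis using j(2) by linarith
  qed simp
qed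

text \<open>Minimality in both directions gives equal absolute values; the comparison of each
  coordinate with its own negative gives the sign.\<close>

lemma consecutive_unique:
  assumes "consecutive n z" "consecutive n z'"
    and ord: "same_order n (\<lambda>i. of_int (z i)) (\<lambda>i. of_int (z' i))" and "i < n"
  shows "z i = z' i"
proof -
  have "\<bar>z i\<bar> = \<bar>z' i\<bar>"
    using consecutive_le[OF assms(1) ord \<open>i < n\<close>]
      consecutive_le[OF assms(2) same_order_sym[OF ord] \<open>i < n\<close>] by linarith
  moreover have "z i \<le> - z i \<longleftrightarrow> z' i \<le> - z' i" "- z i \<le> z i \<longleftrightarrow> - z' i \<le> z' i"
    using same_order_coords(2,3)[OF ord \<open>i < n\<close> \<open>i < n\<close>] by linarith+
  ultimately show ?thesis by linarith
qed

text \<open>Only the larger number has to belong to W; this covers x = 0, which has rank 0.\<close>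

lemma card_le_strict_mono:
  fixes W :: "real set"
  assumes "finite W" "x < y" "y \<in> W"
  shows "card {w \<in> W. w \<le> x} < card {w \<in> W. w \<le> y}"
proof (rule psubset_card_mono)
  have "y \<in> {w \<in> W. w \<le> y}" "y \<notin> {w \<in> W. w \<le> x}" using assms by auto
  moreover have "{w \<in> W. w \<le> x} \<subseteq> {w \<in> W. w \<le> y}" using assms by auto
  ultimately show "{w \<in> W. w \<le> x} \<subset> {w \<in> W. w \<le> y}" by blast
qed (use assms in simp)

text \<open>Ranks have no gaps: the largest element of W below x has rank exactly one less. This is
  the source of \<open>consecutive\<close>.\<close>

lemma card_le_predecessor:
  fixes W :: "real set"
  assumes fin: "finite W" and x: "x \<in> W" and card: "2 \<le> card {w \<in> W. w \<le> x}"
  shows "\<exists>y\<in>W. card {w \<in> W. w \<le> x} = Suc (card {w \<in> W. w \<le> y})"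
proof -
  have ins: "{w \<in> W. w \<le> x} = insert x {w \<in> W. w < x}" using x by auto
  have "{w \<in> W. w < x} \<noteq> {}"
  proof
    assume e: "{w \<in> W. w < x} = {}"
    show False using card unfolding ins e by simp
  qed
  define y where "y = Max {w \<in> W. w < x}"
  have y: "y \<in> W" "y < x" "\<And>w. w \<in> W \<Longrightarrow> w < x \<Longrightarrow> w \<le> y"
    using Max_in[OF _ \<open>{w \<in> W. w < x} \<noteq> {}\<close>] fin unfolding y_def by auto
  then have "{w \<in> W. w < x} = {w \<in> W. w \<le> y}" by force
  then have "card {w \<in> W. w \<le> x} = Suc (card {w \<in> W. w \<le> y})"
    using fin y(2) unfolding ins by simp
  with y(1) show ?thesis by blast
qed

text \<open>Each nonzero coordinate is replaced by the rank of its absolute value, with the same sign.\<close>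

lemma consecutive_exists:
  fixes d :: "nat \<Rightarrow> real"
  obtains z where "consecutive n z" "same_order n d (\<lambda>i. of_int (z i))"
proof -
  \<comment> \<open>Zero is left out so that a zero coordinate gets rank 0 and the others start at
    1.\<close>
  define W where "W = (\<lambda>i. \<bar>d i\<bar>) ` {i. i < n \<and> d i \<noteq> 0}"
  have fin: "finite W" and pos: "\<And>w. w \<in> W \<Longrightarrow> 0 < w" by (auto simp: W_def)
  define g where "g x = int (card {w \<in> W. w \<le> x})" for x
  \<comment> \<open>The odd extension of the rank commutes with negation and hence with
    \<open>signed\<close>.\<close>
  define f where "f x = (if 0 \<le> x then g x else - g (- x))" for x
  have W0: "{w \<in> W. w \<le> 0} = {}" using pos by force
  have g0: "g 0 = 0" unfolding g_def W0 by simp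
  have g_strict: "g x < g y" if "x < y" "y \<in> W" for x y
    using card_le_strict_mono[OF fin that] by (simp add: g_def)
  have g_nonneg: "0 \<le> g x" for x by (simp add: g_def)
  have f_minus: "f (- x) = - f x" for x by (auto simp: f_def g0)
  have abs_f: "\<bar>f x\<bar> = g \<bar>x\<bar>" for x using g_nonneg by (auto simp: f_def)
  \<comment> \<open>The rank is constant between neighbours in \<open>W\<close>, so strictness is
    claimed only for 0 and for values that are elements of \<open>W\<close> up to sign.\<close>
  have f_strict: "f x < f y" if xy: "x < y" and x: "\<bar>x\<bar> \<in> insert 0 W" and y: "\<bar>y\<bar> \<in> insert 0 W" for x y
  proof -
    consider "0 \<le> x" | "x < 0" "0 \<le> y" | "y < 0" by linarith
    then show ?thesis
    proof cases
      case 1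
      then show ?thesis using g_strict[OF xy] xy y by (auto simp: f_def)
    next
      case 2
      then show ?thesis using g_strict[of 0 "- x"] x g0 g_nonneg[of y] by (auto simp: f_def)
    next
      case 3
      then show ?thesis using g_strict[of "- y" "- x"] xy x by (auto simp: f_def)
    qed
  qed
  have f_le: "f x \<le> f y \<longleftrightarrow> x \<le> y" if "\<bar>x\<bar> \<in> insert 0 W" "\<bar>y\<bar> \<in> insert 0 W" for x y
    using f_strict[of x y] f_strict[of y x] that by (cases x y rule: linorder_cases) auto
  have mem: "\<bar>signed n d a\<bar> \<in> insert 0 W" if "a < 2 * n" for a
  proof -
    have "\<bar>d i\<bar> \<in> insert 0 W" if "i < n" for i using that by (auto simp: W_def)
    from this[of a] this[of "a - n"] show ?thesis using that by (auto simp: signed_def)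
  qed
  have signed_f: "signed n (\<lambda>i. of_int (f (d i))) a = of_int (f (signed n d a))" for a
    by (simp add: signed_def f_minus)
  have "same_order n d (\<lambda>i. of_int (f (d i)))"
    unfolding same_order_def signed_f using f_le mem by simp
  moreover have "consecutive n (\<lambda>i. f (d i))"
    unfolding consecutive_def abs_f
  proof (intro allI impI)
    fix i assume i: "i < n" and "2 \<le> g \<bar>d i\<bar>"
    then have "2 \<le> card {w \<in> W. w \<le> \<bar>d i\<bar>}" by (simp add: g_def)
    moreover have "\<bar>d i\<bar> \<in> W"
    proof -
      have "d i \<noteq> 0" using \<open>2 \<le> g \<bar>d i\<bar>\<close> g0 by auto
      then show ?thesis using i by (auto simp: W_def)
    qed
    ultimately obtain y where y: "y \<in> W" "card {w \<in> W. w \<le> \<bar>d i\<bar>} = Suc (card {w \<in> W. w \<le> y})"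
      using card_le_predecessor[OF fin] by blast
    then obtain j where "j < n" "y = \<bar>d j\<bar>" by (auto simp: W_def)
    with y show "\<exists>j<n. g \<bar>d j\<bar> = g \<bar>d i\<bar> - 1" by (auto simp: g_def)
  qed
  ultimately show thesis using that by blast
qed

subsection \<open>Bipartitions as integral weights\<close>

text \<open>A decreasing sequence with finite support has an initial segment as support, so being a
  nonzero part becomes a comparison of the index with the length.\<close>

lemma partition_support:
  assumes "is_partition \<kappa>"
  shows "{i. \<kappa> i \<noteq> 0} = {..<partition_length \<kappa>}"
proof -
  have anti: "antimono \<kappa>" and fin: "finite {i. \<kappa> i \<noteq> 0}"
    using assms by (auto simp: is_partition_def)
  have "\<exists>i. \<kappa> i = 0"
  proof (rule ccontr)
    assume "\<nexists>i. \<kappa> i = 0"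
    then have "{i. \<kappa> i \<noteq> 0} = UNIV" by auto
    then show False using fin by simp
  qed
  then have least: "\<kappa> (LEAST i. \<kappa> i = 0) = 0" by (rule LeastI_ex)
  have "{i. \<kappa> i \<noteq> 0} = {..<(LEAST i. \<kappa> i = 0)}"
  proof (intro Set.set_eqI iffI)
    fix i assume "i \<in> {i. \<kappa> i \<noteq> 0}"
    then have "\<not> (LEAST i. \<kappa> i = 0) \<le> i"
      using antimonoD[OF anti, of "LEAST i. \<kappa> i = 0" i] least by auto
    then show "i \<in> {..<(LEAST i. \<kappa> i = 0)}" by simp
  qed (auto dest: not_less_Least)
  then show ?thesis by (simp add: partition_length_def)
qed

lemma partition_nonzero_iff: "is_partition \<kappa> \<Longrightarrow> \<kappa> i \<noteq> 0 \<longleftrightarrow> i < partition_length \<kappa>"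
  using partition_support by blast

lemma size_parts: "size (parts \<kappa>) = partition_length \<kappa>"
  by (simp add: parts_def partition_length_def)

lemma set_parts: "is_partition \<kappa> \<Longrightarrow> set_mset (parts \<kappa>) = range \<kappa> - {0}"
  by (auto simp: parts_def is_partition_def)

lemma partition_of_parts_range:
  assumes "0 \<notin># M"
  shows "range (partition_of_parts M) - {0} = set_mset M"
proof -
  let ?xs = "rev (sorted_list_of_multiset M)"
  have len: "length ?xs = size M"
    by (metis length_rev mset_sorted_list_of_multiset size_mset)
  have "set_mset M = set ?xs"
    by simp
  also have "\<dots> = {?xs ! i | i. i < size M}"
    using len by (simp only: set_conv_nth)
  finally have set: "set_mset M = {?xs ! i | i. i < size M}" .
  then have "?xs ! i \<noteq> 0" if "i < size M" for i
    using assms that by (metis (mono_tags, lifting) mem_Collect_eq)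
  then show ?thesis
    unfolding set partition_of_parts_def by (force split: if_splits)
qed

lemma partition_of_parts_support:
  assumes "0 \<notin># M"
  shows "{i. partition_of_parts M i \<noteq> 0} = {..<size M}"
proof -
  let ?xs = "rev (sorted_list_of_multiset M)"
  have len: "length ?xs = size M"
    by (metis length_rev mset_sorted_list_of_multiset size_mset)
  have "?xs ! i \<noteq> 0" if "i < size M" for i
  proof -
    have "?xs ! i \<in> set ?xs" using that len by (intro nth_mem) simp
    then have "?xs ! i \<in># M" by simp
    then show ?thesis using assms by metis
  qed
  then show ?thesis by (auto simp: partition_of_parts_def)
qed

lemma partition_of_parts_is_partition:
  assumes "0 \<notin># M"
  shows "is_partition (partition_of_parts M)" "partition_length (partition_of_parts M) = size M"
proof -
  let ?xs = "rev (sorted_list_of_multiset M)"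
  have len: "length ?xs = size M"
    by (metis length_rev mset_sorted_list_of_multiset size_mset)
  have sorted: "sorted_wrt (\<ge>) ?xs"
    by (simp add: sorted_wrt_rev)
  have "antimono (partition_of_parts M)"
  proof (rule antimonoI)
    fix i j :: nat assume "i \<le> j"
    show "partition_of_parts M j \<le> partition_of_parts M i"
    proof (cases "i = j \<or> size M \<le> j")
      case True
      then show ?thesis by (auto simp: partition_of_parts_def)
    next
      case False
      then have "i < j" "j < size M" using \<open>i \<le> j\<close> by auto
      then show ?thesis
        using sorted_wrt_nth_less[OF sorted, of i j] len by (simp add: partition_of_parts_def)
    qed
  qed
  then show "is_partition (partition_of_parts M)"
    unfolding is_partition_def partition_of_parts_support[OF assms] by simp
  show "partition_length (partition_of_parts M) = size M"
    unfolding partition_length_def partition_of_parts_support[OF assms] by simp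
qed

text \<open>A decreasing sequence that ends in 0 has steps of at most one exactly when it skips no
  value. The form with sets of values does not depend on the sorting, so it transfers to a
  merge.\<close>

lemma partition_steps_iff:
  assumes "is_partition \<kappa>"
  shows "(\<forall>i. \<kappa> i \<le> \<kappa> (Suc i) + 1) \<longleftrightarrow> (\<forall>v\<in>range \<kappa>. 2 \<le> v \<longrightarrow> v - 1 \<in> range \<kappa>)"
    (is "?L \<longleftrightarrow> ?R")
proof
  have anti: "antimono \<kappa>" using assms by (auto simp: is_partition_def)
  {
    assume L: ?L
    show ?R
    proof (intro ballI impI)
      fix v assume "v \<in> range \<kappa>" and v: "2 \<le> v"
      then obtain i where i: "v = \<kappa> i" by blast
      have "\<kappa> (partition_length \<kappa>) = 0" using partition_nonzero_iff[OF assms] by blast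
      then have ex: "\<exists>j. \<kappa> j < v" using v by (intro exI[of _ "partition_length \<kappa>"]) simp
      \<comment> \<open>The first index with value below v: its predecessor still has value at least
        v, so a step of at most one lands on v - 1.\<close>
      define j where "j = (LEAST j. \<kappa> j < v)"
      have j: "\<kappa> j < v" unfolding j_def by (rule LeastI_ex[OF ex])
      have "j \<noteq> 0"
      proof
        assume "j = 0"
        then show False using j antimonoD[OF anti, of 0 i] i by simp
      qed
      then obtain k where k: "j = Suc k" by (cases j) auto
      then have "\<not> \<kappa> k < v" unfolding j_def by (metis lessI not_less_Least)
      then have "\<kappa> j = v - 1" using L[rule_format, of k] j k by simp
      then show "v - 1 \<in> range \<kappa>" by (metis rangeI)
    qed
  }
  {
    assume R: ?R
    show ?L
    proof (rule ccontr)
      assume "\<not> ?L"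
      then obtain i where i: "\<kappa> (Suc i) + 1 < \<kappa> i" by (auto simp: not_le)
      then have "\<kappa> i - 1 \<in> range \<kappa>" using R by simp
      then obtain j where j: "\<kappa> j = \<kappa> i - 1" by force
      \<comment> \<open>The value \<open>\<kappa> i - 1\<close> would lie strictly between two
        neighbouring terms, and monotonicity leaves no index for it.\<close>
      have "j \<le> i \<or> Suc i \<le> j" by linarith
      then have "\<kappa> i \<le> \<kappa> j \<or> \<kappa> j \<le> \<kappa> (Suc i)" using antimonoD[OF anti] by blast
      then show False using i j by linarith
    qed
  }
qed

text \<open>The conditions on the sorted merge depend only on the number of parts and on the set of
  values, both visible in \<mu> and \<nu> without sorting.\<close>

lemma BRP_iff:
  "(\<mu>, \<nu>) \<in> BRP n \<longleftrightarrow> is_partition \<mu> \<and> is_partition \<nu> \<and>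
     partition_length \<mu> + partition_length \<nu> \<le> n \<and>
     (\<forall>v\<in>range \<mu> \<union> range \<nu>. 2 \<le> v \<longrightarrow> v - 1 \<in> range \<mu> \<union> range \<nu>)"
    (is ?thesis1)
  and BRP_merge_RP0_iff:
  "(\<mu>, \<nu>) \<in> BRP n \<Longrightarrow> partition_merge \<mu> \<nu> \<in> RP0 n \<longleftrightarrow>
     partition_length \<mu> + partition_length \<nu> = n" (is "?A \<Longrightarrow> ?thesis2")
proof -
  have *: "(partition_merge \<mu> \<nu> \<in> RP n \<longleftrightarrow> partition_length \<mu> + partition_length \<nu> \<le> n \<and>
      (\<forall>v\<in>range \<mu> \<union> range \<nu>. 2 \<le> v \<longrightarrow> v - 1 \<in> range \<mu> \<union> range \<nu>)) \<and>
    (partition_merge \<mu> \<nu> \<in> RP0 n \<longleftrightarrow> partition_length \<mu> + partition_length \<nu> = n \<and>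
      (\<forall>v\<in>range \<mu> \<union> range \<nu>. 2 \<le> v \<longrightarrow> v - 1 \<in> range \<mu> \<union> range \<nu>))"
    if part: "is_partition \<mu>" "is_partition \<nu>"
  proof -
    define M where "M = parts \<mu> + parts \<nu>"
    have M0: "0 \<notin># M" using set_parts part by (auto simp: M_def)
    have size: "size M = partition_length \<mu> + partition_length \<nu>"
      by (simp add: M_def size_parts)
    have "range (partition_of_parts M) - {0} = (range \<mu> \<union> range \<nu>) - {0}"
      unfolding partition_of_parts_range[OF M0] using set_parts part by (auto simp: M_def)
    \<comment> \<open>The value sets agree away from 0, which is enough: v \<ge> 2 makes v - 1
      nonzero as well.\<close>
    then have "v \<in> range (partition_of_parts M) \<longleftrightarrow> v \<in> range \<mu> \<union> range \<nu>" if "1 \<le> v" for v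
      using that by (metis DiffI Diff_iff not_one_le_zero singletonD)
    then have "(\<forall>v\<in>range (partition_of_parts M). 2 \<le> v \<longrightarrow> v - 1 \<in> range (partition_of_parts M))
        \<longleftrightarrow> (\<forall>v\<in>range \<mu> \<union> range \<nu>. 2 \<le> v \<longrightarrow> v - 1 \<in> range \<mu> \<union> range \<nu>)"
      by (metis Nat.le_diff_conv2 add_leD2 one_add_one)
    then show ?thesis
      using partition_of_parts_is_partition[OF M0] size
        partition_steps_iff[OF partition_of_parts_is_partition(1)[OF M0]]
      by (auto simp: RP_def RP0_def partition_merge_def M_def)
  qed
  show ?thesis1 using * by (auto simp: BRP_def)
  show "?A \<Longrightarrow> ?thesis2" using * by (auto simp: BRP_def)
qed

section \<open>Integer coordinates of bipartitions\<close>

definition int_coords :: "nat \<Rightarrow> (nat \<Rightarrow> nat) \<times> (nat \<Rightarrow> nat) \<Rightarrow> nat \<Rightarrow> int" where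
  "int_coords n x k = int (fst x k) - int (snd x (n - 1 - k))"

definition dominant :: "nat \<Rightarrow> (nat \<Rightarrow> 'a :: linorder) \<Rightarrow> bool" where
  "dominant n z \<longleftrightarrow> (\<forall>i j. i \<le> j \<longrightarrow> j < n \<longrightarrow> z j \<le> z i)"

text \<open>The parts of \<mu> fill positions from the left and those of \<nu> from the right; with
  at most n parts in total they do not overlap, so nothing cancels in the weight.\<close>

lemma BRP_disjoint:
  assumes "(\<mu>, \<nu>) \<in> BRP n" "k < n"
  shows "\<mu> k = 0 \<or> \<nu> (n - 1 - k) = 0"
  using assms partition_nonzero_iff[of \<mu> k] partition_nonzero_iff[of \<nu> "n - 1 - k"]
  unfolding BRP_iff by linarith

lemma BRP_vanish:
  assumes "(\<mu>, \<nu>) \<in> BRP n" "n \<le> k"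
  shows "\<mu> k = 0" "\<nu> k = 0"
  using assms partition_nonzero_iff[of \<mu> k] partition_nonzero_iff[of \<nu> k]
  unfolding BRP_iff by linarith+

lemma abs_int_coords:
  assumes "(\<mu>, \<nu>) \<in> BRP n" "k < n"
  shows "\<bar>int_coords n (\<mu>, \<nu>) k\<bar> = int (\<mu> k + \<nu> (n - 1 - k))"
  using BRP_disjoint[OF assms] by (auto simp: int_coords_def)

text \<open>Links \<open>consecutive\<close> to the condition on parts. Zero is set apart because
  the range of a partition always contains it, while the coordinates may avoid it.\<close>

lemma abs_int_coords_range:
  assumes x: "(\<mu>, \<nu>) \<in> BRP n" and "v \<noteq> 0"
  shows "(\<exists>k<n. \<bar>int_coords n (\<mu>, \<nu>) k\<bar> = int v) \<longleftrightarrow> v \<in> range \<mu> \<union> range \<nu>"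
proof
  assume "\<exists>k<n. \<bar>int_coords n (\<mu>, \<nu>) k\<bar> = int v"
  then obtain k where k: "k < n" "v = \<mu> k + \<nu> (n - 1 - k)"
    using abs_int_coords[OF x] by auto
  then show "v \<in> range \<mu> \<union> range \<nu>" using BRP_disjoint[OF x k(1)] by auto
next
  assume "v \<in> range \<mu> \<union> range \<nu>"
  then consider k where "v = \<mu> k" | k where "v = \<nu> k" by blast
  then show "\<exists>k<n. \<bar>int_coords n (\<mu>, \<nu>) k\<bar> = int v"
  proof cases
    case 1
    then have k: "k < n" using BRP_vanish[OF x, of k] \<open>v \<noteq> 0\<close> by (meson not_less)
    then show ?thesis using abs_int_coords[OF x k] BRP_disjoint[OF x k] 1 \<open>v \<noteq> 0\<close> by auto
  next
    case 2
    then have k: "k < n" using BRP_vanish[OF x, of k] \<open>v \<noteq> 0\<close> by (meson not_less)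
    then have "n - 1 - k < n" "n - 1 - (n - 1 - k) = k" by auto
    then show ?thesis
      using abs_int_coords[OF x, of "n - 1 - k"] BRP_disjoint[OF x, of "n - 1 - k"] 2 \<open>v \<noteq> 0\<close>
      by auto
  qed
qed

lemma int_coords_dominant:
  assumes "x \<in> BRP n"
  shows "dominant n (int_coords n x)"
  unfolding dominant_def
proof (intro allI impI)
  obtain \<mu> \<nu> where x: "x = (\<mu>, \<nu>)" by fastforce
  fix i j assume "i \<le> j" "j < n"
  then have "\<mu> j \<le> \<mu> i" "\<nu> (n - 1 - i) \<le> \<nu> (n - 1 - j)"
    using assms unfolding x BRP_iff is_partition_def by (auto intro: antimonoD)
  then show "int_coords n x j \<le> int_coords n x i" by (simp add: x int_coords_def)
qed

lemma int_coords_consecutive: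
  assumes "x \<in> BRP n"
  shows "consecutive n (int_coords n x)"
  unfolding consecutive_def
proof (intro allI impI)
  obtain \<mu> \<nu> where x: "x = (\<mu>, \<nu>)" by fastforce
  note BRP = assms[unfolded x]
  fix i assume i: "i < n" "2 \<le> \<bar>int_coords n x i\<bar>"
  define v where "v = nat \<bar>int_coords n x i\<bar>"
  have v: "\<bar>int_coords n x i\<bar> = int v" "2 \<le> v" using i by (auto simp: v_def)
  then have "v \<in> range \<mu> \<union> range \<nu>"
    using abs_int_coords_range[OF BRP, of v] i unfolding x by auto
  then have "v - 1 \<in> range \<mu> \<union> range \<nu>" using BRP v(2) unfolding BRP_iff by blast
  then show "\<exists>j<n. \<bar>int_coords n x j\<bar> = \<bar>int_coords n x i\<bar> - 1"
    using abs_int_coords_range[OF BRP, of "v - 1"] v unfolding x by (simp add: of_nat_diff)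
qed

lemma int_coords_inj:
  assumes x: "x \<in> BRP n" and y: "y \<in> BRP n"
    and eq: "\<And>k. k < n \<Longrightarrow> int_coords n x k = int_coords n y k"
  shows "x = y"
proof -
  obtain \<mu> \<nu> \<mu>' \<nu>' where xy: "x = (\<mu>, \<nu>)" "y = (\<mu>', \<nu>')" by fastforce
  note x = x[unfolded xy] and y = y[unfolded xy]
  have k: "\<mu> k = \<mu>' k \<and> \<nu> (n - 1 - k) = \<nu>' (n - 1 - k)" if "k < n" for k
    using eq[OF that] BRP_disjoint[OF x that] BRP_disjoint[OF y that]
    by (auto simp: xy int_coords_def)
  have "\<mu> k = \<mu>' k" for k
    using k[of k] BRP_vanish(1)[OF x, of k] BRP_vanish(1)[OF y, of k] by (cases "k < n") auto
  moreover have "\<nu> k = \<nu>' k" for k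
    using k[of "n - 1 - k"] BRP_vanish(2)[OF x, of k] BRP_vanish(2)[OF y, of k]
    by (cases "k < n") auto
  ultimately show ?thesis by (auto simp: xy)
qed

lemma int_coords_surj:
  assumes dom: "dominant n z" and cons: "consecutive n z"
  obtains x where "x \<in> BRP n" "\<And>k. k < n \<Longrightarrow> int_coords n x k = z k"
proof -
  define \<mu> where "\<mu> k = (if k < n then nat (z k) else 0)" for k
  define \<nu> where "\<nu> k = (if k < n then nat (- z (n - 1 - k)) else 0)" for k
  have fin: "finite {i. \<mu> i \<noteq> 0}" "finite {i. \<nu> i \<noteq> 0}"
    by (rule finite_subset[of _ "{..<n}"]; auto simp: \<mu>_def \<nu>_def split: if_splits)+
  have "antimono \<mu>"
    using dom by (auto intro!: antimonoI nat_mono simp: \<mu>_def dominant_def)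
  moreover have "antimono \<nu>"
  proof (rule antimonoI)
    fix i j :: nat assume "i \<le> j"
    show "\<nu> j \<le> \<nu> i"
    proof (cases "j < n")
      case True
      then have "z (n - 1 - i) \<le> z (n - 1 - j)"
        using dom \<open>i \<le> j\<close> by (auto simp: dominant_def)
      then show ?thesis using True \<open>i \<le> j\<close> by (simp add: \<nu>_def nat_mono)
    qed (simp add: \<nu>_def)
  qed
  ultimately have part: "is_partition \<mu>" "is_partition \<nu>" using fin by (auto simp: is_partition_def)
  have disj: "\<mu> k = 0 \<or> \<nu> (n - 1 - k) = 0" if "k < n" for k
    using that by (auto simp: \<mu>_def \<nu>_def)
  have len: "partition_length \<mu> + partition_length \<nu> \<le> n"
  proof (rule ccontr)
    assume gt: "\<not> ?thesis"
    have "partition_length \<mu> \<le> n" "partition_length \<nu> \<le> n"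
      using partition_nonzero_iff[OF part(1), of n] partition_nonzero_iff[OF part(2), of n]
      by (auto simp: \<mu>_def \<nu>_def)
    \<comment> \<open>Too many parts would make the last position of \<mu> also a position of the
      reversed \<nu>; it exists because \<nu> alone has at most n parts.\<close>
    then have "partition_length \<mu> - 1 < n" "partition_length \<mu> - 1 < partition_length \<mu>"
      "n - 1 - (partition_length \<mu> - 1) < partition_length \<nu>"
      using gt by linarith+
    then show False
      using disj partition_nonzero_iff[OF part(1)] partition_nonzero_iff[OF part(2)] by blast
  qed
  have coords: "int_coords n (\<mu>, \<nu>) k = z k" if "k < n" for k
    using that by (auto simp: int_coords_def \<mu>_def \<nu>_def)
  have range: "v \<in> range \<mu> \<union> range \<nu> \<longleftrightarrow> (\<exists>k<n. \<bar>z k\<bar> = int v)" if "v \<noteq> 0" for v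
  proof
    assume "v \<in> range \<mu> \<union> range \<nu>"
    then consider k where "v = \<mu> k" | k where "v = \<nu> k" by blast
    then show "\<exists>k<n. \<bar>z k\<bar> = int v"
    proof cases
      case 1
      then show ?thesis using that by (intro exI[of _ k]) (auto simp: \<mu>_def split: if_splits)
    next
      case 2
      then show ?thesis
        using that by (intro exI[of _ "n - 1 - k"]) (auto simp: \<nu>_def split: if_splits)
    qed
  next
    assume "\<exists>k<n. \<bar>z k\<bar> = int v"
    then obtain k where k: "k < n" "\<bar>z k\<bar> = int v" by blast
    then have "v = \<mu> k \<or> v = \<nu> (n - 1 - k)" by (auto simp: \<mu>_def \<nu>_def)
    then show "v \<in> range \<mu> \<union> range \<nu>" by auto
  qed
  have "v - 1 \<in> range \<mu> \<union> range \<nu>" if v: "v \<in> range \<mu> \<union> range \<nu>" "2 \<le> v" for v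
  proof -
    obtain k where k: "k < n" "\<bar>z k\<bar> = int v" using range[of v] v by auto
    then obtain j where "j < n" "\<bar>z j\<bar> = int v - 1"
      using cons v(2) unfolding consecutive_def by force
    then show ?thesis using range[of "v - 1"] v(2) by (auto simp: of_nat_diff)
  qed
  then have "(\<mu>, \<nu>) \<in> BRP n" using part len unfolding BRP_iff by blast
  with coords show thesis using that by blast
qed

text \<open>The case i = j excludes zero coordinates, which amounts to n nonzero parts; for i
  \<noteq> j a vanishing sum is a part shared by \<mu> and \<nu>.\<close>

lemma BRP0_iff:
  assumes "x \<in> BRP n"
  shows "x \<in> BRP0 n \<longleftrightarrow> (\<forall>i<n. \<forall>j<n. int_coords n x i + int_coords n x j \<noteq> 0)"
    (is "_ \<longleftrightarrow> ?R")
proof -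
  obtain \<mu> \<nu> where x: "x = (\<mu>, \<nu>)" by fastforce
  note BRP = assms[unfolded x]
  have part: "is_partition \<mu>" "is_partition \<nu>"
    and len: "partition_length \<mu> + partition_length \<nu> \<le> n"
    using BRP unfolding BRP_iff by blast+
  have "x \<in> BRP0 n \<longleftrightarrow> partition_length \<mu> + partition_length \<nu> = n
      \<and> (\<forall>i j. \<mu> i = \<nu> j \<longrightarrow> \<mu> i = 0 \<and> \<nu> j = 0)"
    using assms BRP_merge_RP0_iff[OF BRP] by (simp add: BRP0_def x)
  also have "\<dots> \<longleftrightarrow> ?R"
  proof
    assume L: "partition_length \<mu> + partition_length \<nu> = n
      \<and> (\<forall>i j. \<mu> i = \<nu> j \<longrightarrow> \<mu> i = 0 \<and> \<nu> j = 0)"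
    show ?R
    proof (intro allI impI)
      fix i j assume ij: "i < n" "j < n"
      have nz: "\<mu> k \<noteq> 0 \<or> \<nu> (n - 1 - k) \<noteq> 0" if "k < n" for k
        using partition_nonzero_iff[OF part(1), of k] partition_nonzero_iff[OF part(2), of "n - 1 - k"]
          L that by linarith
      show "int_coords n x i + int_coords n x j \<noteq> 0"
        using nz[OF ij(1)] nz[OF ij(2)] BRP_disjoint[OF BRP ij(1)] BRP_disjoint[OF BRP ij(2)]
          L[THEN conjunct2, rule_format, of i "n - 1 - j"]
          L[THEN conjunct2, rule_format, of j "n - 1 - i"]
        by (auto simp: x int_coords_def)
    qed
  next
    assume R: ?R
    have "partition_length \<mu> + partition_length \<nu> = n"
    proof (rule ccontr)
      assume "partition_length \<mu> + partition_length \<nu> \<noteq> n"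
      \<comment> \<open>With fewer than n parts the position right after \<mu> is a gap, which
        violates the condition for i = j.\<close>
      then have k: "partition_length \<mu> < n" and "partition_length \<nu> \<le> n - 1 - partition_length \<mu>"
        using len by linarith+
      then have "\<mu> (partition_length \<mu>) = 0" "\<nu> (n - 1 - partition_length \<mu>) = 0"
        using partition_nonzero_iff[OF part(1)] partition_nonzero_iff[OF part(2)] by (meson not_less order_refl)+
      then have "int_coords n x (partition_length \<mu>) = 0" by (simp add: x int_coords_def)
      then show False using R k by force
    qed
    moreover have "\<mu> i = 0 \<and> \<nu> j = 0" if eq: "\<mu> i = \<nu> j" for i j
    proof (rule ccontr)
      assume "\<not> ?thesis"
      then have nz: "\<mu> i \<noteq> 0" "\<nu> j \<noteq> 0" using eq by auto
      then have i: "i < n" and "j < n" using BRP_vanish[OF BRP] by (meson not_less)+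
      then have j: "n - 1 - j < n" "n - 1 - (n - 1 - j) = j" by auto
      have "\<nu> (n - 1 - i) = 0" "\<mu> (n - 1 - j) = 0"
        using BRP_disjoint[OF BRP i] BRP_disjoint[OF BRP j(1)] nz j(2) by auto
      then have "int_coords n x i + int_coords n x (n - 1 - j) = 0"
        using eq j(2) by (simp add: x int_coords_def)
      then show False using R i j(1) by blast
    qed
    ultimately show "partition_length \<mu> + partition_length \<nu> = n
      \<and> (\<forall>i j. \<mu> i = \<nu> j \<longrightarrow> \<mu> i = 0 \<and> \<nu> j = 0)" by blast
  qed
  finally show ?thesis .
qed

lemma downward_closed_atLeastAtMost:
  fixes A :: "nat set"
  assumes fin: "finite A" and pos: "0 \<notin> A" and down: "\<And>v. v \<in> A \<Longrightarrow> 2 \<le> v \<Longrightarrow> v - 1 \<in> A"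
  shows "A = {1..card A}"
proof (cases "A = {}")
  case False
  have "{1..v} \<subseteq> A" if "v \<in> A" for v
    using that
  proof (induction v)
    case (Suc v)
    show ?case
    proof (cases "v = 0")
      case False
      then have "{1..v} \<subseteq> A" using down[OF Suc.prems] Suc.IH by simp
      then show ?thesis using Suc.prems by (auto simp: atLeastAtMostSuc_conv)
    qed (use Suc.prems in auto)
  qed simp
  then have "{1..Max A} \<subseteq> A" using Max_in[OF fin False] by blast
  moreover have "A \<subseteq> {1..Max A}"
    using pos Max_ge[OF fin] by (auto simp: Suc_le_eq intro!: Nat.gr0I)
  ultimately have "A = {1..Max A}" by blast
  moreover from this have "card A = Max A" by (metis card_atLeastAtMost diff_Suc_1)
  ultimately show ?thesis by simp
qed simp

text \<open>As many elements as distinct values: no part repeats, so the multiset is the set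
  {1..n}.\<close>

lemma partition_of_parts_staircase:
  assumes "set_mset M = {1..n}" "size M = n"
  shows "partition_of_parts M = staircase n"
proof
  fix i
  have "M = mset_set {1..n}"
  proof -
    have "mset_set (set_mset M) \<subseteq># M" by (rule mset_set_set_mset_msubset)
    moreover have "size (mset_set (set_mset M)) = size M" using assms by simp
    ultimately show ?thesis using assms(1) by (metis mset_subset_size nless_le subset_mset.le_imp_less_or_eq)
  qed
  then have "sorted_list_of_multiset M = sorted_list_of_set {1..n}"
    by (simp add: sorted_list_of_mset_set)
  also have "\<dots> = [1..<Suc n]"
    by (metis atLeastLessThanSuc_atLeastAtMost sorted_list_of_set_range)
  finally have "rev (sorted_list_of_multiset M) = rev [1..<Suc n]" by simp
  then show "partition_of_parts M i = staircase n i"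
    using assms(2) by (simp add: partition_of_parts_def staircase_def rev_nth Suc_diff_Suc del: upt_Suc)
qed

text \<open>When no two coordinates are opposite, distinct coordinates have distinct absolute
  values. These form an initial segment of the positive integers, which is {1..n} exactly when there
  are n of them.\<close>

lemma BRP00_iff:
  assumes "x \<in> BRP n"
  shows "x \<in> BRP00 n \<longleftrightarrow> (\<forall>i<n. \<forall>j<n. int_coords n x i + int_coords n x j \<noteq> 0)
    \<and> (\<forall>i<n. \<forall>j<n. i \<noteq> j \<longrightarrow> int_coords n x i \<noteq> int_coords n x j)" (is "_ \<longleftrightarrow> ?R0 \<and> ?R1")
proof (cases "x \<in> BRP0 n")
  case True
  obtain \<mu> \<nu> where x: "x = (\<mu>, \<nu>)" by fastforce
  note BRP = assms[unfolded x]
  define M where "M = parts \<mu> + parts \<nu>"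
  define A where "A = (\<lambda>k. nat \<bar>int_coords n x k\<bar>) ` {..<n}"
  have part: "is_partition \<mu>" "is_partition \<nu>" using BRP unfolding BRP_iff by blast+
  have M0: "0 \<notin># M" using set_parts part by (auto simp: M_def)
  have size: "size M = n"
    using True BRP_merge_RP0_iff[OF BRP] by (simp add: M_def size_parts BRP0_def x)
  have R0: ?R0 using True BRP0_iff[OF assms] by blast
  have A0: "0 \<notin> A" using R0 by (force simp: A_def)
  have set: "set_mset M = A"
  proof (rule Set.set_eqI)
    fix v
    show "v \<in># M \<longleftrightarrow> v \<in> A"
    proof (cases "v = 0")
      case False
      then have "v \<in># M \<longleftrightarrow> v \<in> range \<mu> \<union> range \<nu>" using set_parts part by (auto simp: M_def)
      also have "\<dots> \<longleftrightarrow> (\<exists>k<n. \<bar>int_coords n x k\<bar> = int v)"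
        using abs_int_coords_range[OF BRP False] by (simp add: x)
      also have "\<dots> \<longleftrightarrow> v \<in> A" by (force simp: A_def)
      finally show ?thesis .
    qed (use M0 A0 in simp)
  qed
  have down: "v - 1 \<in> A" if "v \<in> A" "2 \<le> v" for v
  proof -
    have "v \<in> range \<mu> \<union> range \<nu>" using that set set_parts part by (auto simp: M_def)
    then have "v - 1 \<in> range \<mu> \<union> range \<nu>" using BRP that unfolding BRP_iff by blast
    then show ?thesis using that set set_parts part by (auto simp: M_def)
  qed
  have "partition_merge \<mu> \<nu> = staircase n \<longleftrightarrow> A = {1..n}"
  proof
    assume "partition_merge \<mu> \<nu> = staircase n"
    then have "A = range (staircase n) - {0}"
      using partition_of_parts_range[OF M0] set by (simp add: partition_merge_def M_def)
    also have "\<dots> = {1..n}"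
    proof (intro Set.set_eqI iffI)
      fix v assume "v \<in> {1..n}"
      then have "v = staircase n (n - v)" "v \<noteq> 0" by (auto simp: staircase_def)
      then show "v \<in> range (staircase n) - {0}" by blast
    qed (auto simp: staircase_def)
    finally show "A = {1..n}" .
  qed (use partition_of_parts_staircase set size in \<open>simp add: partition_merge_def M_def\<close>)
  also have "\<dots> \<longleftrightarrow> card A = n"
    using downward_closed_atLeastAtMost[OF _ A0 down] by (auto simp: A_def)
  also have "\<dots> \<longleftrightarrow> inj_on (\<lambda>k. nat \<bar>int_coords n x k\<bar>) {..<n}"
    unfolding A_def inj_on_iff_eq_card[OF finite_lessThan] by simp
  also have "\<dots> \<longleftrightarrow> ?R1"
  proof
    assume inj: "inj_on (\<lambda>k. nat \<bar>int_coords n x k\<bar>) {..<n}"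
    show ?R1 using inj_onD[OF inj] by force
  next
    assume R1: ?R1
    show "inj_on (\<lambda>k. nat \<bar>int_coords n x k\<bar>) {..<n}"
    proof (rule inj_onI)
      fix i j assume ij: "i \<in> {..<n}" "j \<in> {..<n}"
        and "nat \<bar>int_coords n x i\<bar> = nat \<bar>int_coords n x j\<bar>"
      then have "int_coords n x i = int_coords n x j \<or> int_coords n x i + int_coords n x j = 0"
        by linarith
      then show "i = j" using R0 R1 ij by blast
    qed
  qed
  finally show ?thesis using True R0 by (simp add: BRP00_def x)
next
  case False
  then show ?thesis using BRP0_iff[OF assms] by (auto simp: BRP00_def)
qed

subsection \<open>Parabolic decompositions and signed orders\<close>

lemma root_matrix_levi:
  assumes al: "allowed n a b" and eq: "signed n (re_coords \<delta>) a = signed n (re_coords \<delta>) b"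
  shows "root_matrix n a b \<in> levi n \<delta>"
proof -
  have ab: "a < 2*n" "b < 2*n" using al by (auto simp: allowed_def)
  have "signed n (re_coords \<delta>) c = signed n (re_coords \<delta>) d"
    if "c < 2*n" "d < 2*n" "root_matrix n a b $$ (c, d) \<noteq> 0" for c d
    using root_matrix_support[OF ab that] eq signed_flip[OF ab(1), of "re_coords \<delta>"]
      signed_flip[OF ab(2), of "re_coords \<delta>"] by (elim disjE conjE; simp)
  then show ?thesis unfolding levi_iff using root_matrix_periplectic[OF ab] by blast
qed

lemma levi_eqD:
  assumes "levi n \<delta> = levi n \<delta>'" "allowed n a b"
    and "signed n (re_coords \<delta>) a = signed n (re_coords \<delta>) b"
  shows "signed n (re_coords \<delta>') a = signed n (re_coords \<delta>') b"
proof -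
  have "root_matrix n a b \<in> levi n \<delta>'" using root_matrix_levi[OF assms(2,3)] assms(1) by simp
  then show ?thesis
    by (rule levi_iff[THEN iffD1, THEN conjunct2, rule_format])
      (use assms(2) root_matrix_nonzero[OF assms(2)] in \<open>auto simp: allowed_def\<close>)
qed

text \<open>An excluded entry lies in the lower left block, so its transpose lies in the upper right
  block, where every entry is allowed.\<close>

lemma allowed_swap:
  assumes "a < 2*n" "b < 2*n"
  shows "allowed n a b \<or> allowed n b a"
  using assms by (auto simp: allowed_def flip_def)

lemma parabolic_eqD:
  assumes "parabolic n \<delta> = parabolic n \<delta>'" "allowed n a b"
  shows "signed n (re_coords \<delta>) b \<le> signed n (re_coords \<delta>) a
    \<longleftrightarrow> signed n (re_coords \<delta>') b \<le> signed n (re_coords \<delta>') a"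
  using assms parabolic_subset_iff[of n \<delta> \<delta>'] parabolic_subset_iff[of n \<delta>' \<delta>] by blast

text \<open>For an allowed (a, b) the parabolic subalgebra decides s_b \<le> s_a. If the transposed
  entry is excluded, knowing equality yields the reverse comparison by linearity. The premise
  \<open>eq\<close> is where the Levi subalgebra or regularity enters.\<close>

lemma same_order_of_parabolic:
  assumes P: "parabolic n \<delta> = parabolic n \<delta>'"
    and eq: "\<And>a b. allowed n a b \<Longrightarrow> \<not> allowed n b a \<Longrightarrow>
      signed n (re_coords \<delta>) a = signed n (re_coords \<delta>) b
        \<longleftrightarrow> signed n (re_coords \<delta>') a = signed n (re_coords \<delta>') b"
  shows "same_order n (re_coords \<delta>) (re_coords \<delta>')"
  unfolding same_order_def
proof (intro allI impI)
  fix a b assume ab: "a < 2*n" "b < 2*n"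
  show "signed n (re_coords \<delta>) a \<le> signed n (re_coords \<delta>) b
    \<longleftrightarrow> signed n (re_coords \<delta>') a \<le> signed n (re_coords \<delta>') b"
  proof (cases "allowed n b a")
    case True
    then show ?thesis by (rule parabolic_eqD[OF P])
  next
    case False
    then have al: "allowed n a b" using allowed_swap[OF ab] by blast
    show ?thesis using parabolic_eqD[OF P al] eq[OF al False] by linarith
  qed
qed

lemma same_order_eq:
  assumes "same_order n d d'" "a < 2*n" "b < 2*n"
  shows "signed n d a = signed n d b \<longleftrightarrow> signed n d' a = signed n d' b"
  using assms unfolding same_order_def by (simp add: order_eq_iff)

lemma parabolic_levi_cong:
  assumes ord: "same_order n (re_coords \<delta>) (re_coords \<delta>')"
  shows "parabolic n \<delta> = parabolic n \<delta>'" "levi n \<delta> = levi n \<delta>'"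
proof -
  have le: "signed n (re_coords \<delta>) a \<le> signed n (re_coords \<delta>) b
      \<longleftrightarrow> signed n (re_coords \<delta>') a \<le> signed n (re_coords \<delta>') b" if "a < 2*n" "b < 2*n" for a b
    using ord that unfolding same_order_def by blast
  show "parabolic n \<delta> = parabolic n \<delta>'"
    by (rule Set.set_eqI) (simp add: parabolic_iff le cong: conj_cong)
  show "levi n \<delta> = levi n \<delta>'"
    by (rule Set.set_eqI) (simp add: levi_iff same_order_eq[OF ord] cong: conj_cong)
qed

text \<open>The Levi subalgebra supplies the equality at the entries (i, i + n), where the parabolic
  subalgebra gives only one comparison.\<close>

lemma parabolic_levi_eq_iff:
  "parabolic n \<delta> = parabolic n \<delta>' \<and> levi n \<delta> = levi n \<delta>'
    \<longleftrightarrow> same_order n (re_coords \<delta>) (re_coords \<delta>')" (is "?L \<longleftrightarrow> _")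
proof
  assume L: ?L
  show "same_order n (re_coords \<delta>) (re_coords \<delta>')"
    by (rule same_order_of_parabolic) (use L levi_eqD[of n \<delta> \<delta>'] levi_eqD[of n \<delta>' \<delta>] in metis)+
qed (simp add: parabolic_levi_cong)

text \<open>The even Borel subalgebra contains the root matrices of all (i, j) with i \<le> j < n,
  and each forces d_j \<le> d_i.\<close>

lemma std_even_borel_subset_iff:
  "std_even_borel n \<subseteq> parabolic n \<delta> \<longleftrightarrow> dominant n (re_coords \<delta>)" (is "?L \<longleftrightarrow> ?R")
proof
  assume L: ?L
  show ?R
    unfolding dominant_def
  proof (intro allI impI)
    fix i j assume ij: "i \<le> j" "j < n"
    then have ij': "i < 2*n" "j < 2*n" "allowed n i j" by (auto simp: allowed_def)
    have supp: "c = i \<and> d = j \<or> c = j + n \<and> d = i + n"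
      if "c < 2*n" "d < 2*n" "root_matrix n i j $$ (c, d) \<noteq> 0" for c d
      using root_matrix_support[OF ij'(1,2) that] ij by (simp add: flip_def)
    have "root_matrix n i j \<in> std_even_borel n"
      unfolding std_even_borel_iff periplectic_even_iff
    proof (intro conjI allI impI)
      fix c d assume "c < 2*n" "d < 2*n" "root_matrix n i j $$ (c, d) \<noteq> 0"
      from supp[OF this] show "c < n \<longleftrightarrow> d < n" using ij by linarith
    next
      fix c d assume cd: "c < n" "d < n" "root_matrix n i j $$ (c, d) \<noteq> 0"
      then have "c < 2*n" "d < 2*n" by auto
      from supp[OF this cd(3)] show "c \<le> d" using ij cd by linarith
    qed (rule root_matrix_periplectic[OF ij'(1,2)])
    then have "root_matrix n i j \<in> parabolic n \<delta>" using L by blast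
    then have "signed n (re_coords \<delta>) j \<le> signed n (re_coords \<delta>) i"
      by (rule parabolic_iff[THEN iffD1, THEN conjunct2, rule_format])
        (use ij' root_matrix_nonzero[OF ij'(3)] in auto)
    then show "re_coords \<delta> j \<le> re_coords \<delta> i" using ij by (simp add: signed_def)
  qed
next
  assume R: ?R
  show ?L
  proof
    fix X assume X: "X \<in> std_even_borel n"
    then have per: "X \<in> periplectic n"
      and even: "\<And>a b. a < 2*n \<Longrightarrow> b < 2*n \<Longrightarrow> X $$ (a, b) \<noteq> 0 \<Longrightarrow> a < n \<longleftrightarrow> b < n"
      and tri: "\<And>a b. a < n \<Longrightarrow> b < n \<Longrightarrow> X $$ (a, b) \<noteq> 0 \<Longrightarrow> a \<le> b"
      unfolding std_even_borel_iff periplectic_even_iff by blast+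
    have "signed n (re_coords \<delta>) b \<le> signed n (re_coords \<delta>) a"
      if ab: "a < 2*n" "b < 2*n" "X $$ (a, b) \<noteq> 0" for a b
    proof (cases "a < n")
      case True
      then have "b < n" using even[OF ab] by simp
      then show ?thesis using R True tri[OF True _ ab(3)] by (simp add: signed_def dominant_def)
    next
      case False
      then have b: "\<not> b < n" using even[OF ab] by simp
      \<comment> \<open>Triangularity is known only for the upper left block, so a lower right entry
        is moved there by the mirror.\<close>
      have "X $$ (flip n b, flip n a) \<noteq> 0" using periplectic_sym[OF per ab(1,2)] ab(3) by auto
      then have "X $$ (b - n, a - n) \<noteq> 0" using False b by (simp add: flip_def)
      then have "b - n \<le> a - n" using tri[of "b - n" "a - n"] ab False b by simp
      moreover have "a - n < n" using ab(1) by auto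
      ultimately show ?thesis using R False b by (simp add: signed_def dominant_def)
    qed
    then show "X \<in> parabolic n \<delta>" unfolding parabolic_iff using per by blast
  qed
qed

text \<open>Up to sign, z_i + z_j is the pairing with an odd root; i = j accounts for
  2\<epsilon>_i.\<close>

definition odd_regular :: "nat \<Rightarrow> (nat \<Rightarrow> 'a :: ab_group_add) \<Rightarrow> bool" where
  "odd_regular n z \<longleftrightarrow> (\<forall>i<n. \<forall>j<n. z i + z j \<noteq> 0)"

lemma levi_even_iff:
  "levi n \<delta> \<subseteq> periplectic_even n \<longleftrightarrow> odd_regular n (re_coords \<delta>)" (is "?L \<longleftrightarrow> ?R")
proof
  assume L: ?L
  show ?R
    unfolding odd_regular_def
  proof (intro allI impI notI)
    fix i j assume ij: "i < n" "j < n" and "re_coords \<delta> i + re_coords \<delta> j = 0"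
    then have "signed n (re_coords \<delta>) i = signed n (re_coords \<delta>) (j + n)" by (simp add: signed_def)
    \<comment> \<open>The upper right block serves as test because it has no excluded entry, even
      for i = j.\<close>
    moreover have al: "allowed n i (j + n)" using ij by (auto simp: allowed_def)
    ultimately have "root_matrix n i (j + n) \<in> periplectic_even n" using L root_matrix_levi by blast
    then have "i < n \<longleftrightarrow> j + n < n"
      by (rule periplectic_even_iff[THEN iffD1, THEN conjunct2, rule_format])
        (use ij root_matrix_nonzero[OF al] in auto)
    then show False using ij by simp
  qed
next
  assume R: ?R
  show ?L
  proof
    fix X assume X: "X \<in> levi n \<delta>"
    have "a < n \<longleftrightarrow> b < n" if ab: "a < 2*n" "b < 2*n" "X $$ (a, b) \<noteq> 0" for a b
    proof (rule ccontr)
      have s: "signed n (re_coords \<delta>) a = signed n (re_coords \<delta>) b"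
        by (rule levi_iff[THEN iffD1, OF X, THEN conjunct2, rule_format]) (use ab in auto)
      assume "\<not> ?thesis"
      then consider "a < n" "\<not> b < n" | "\<not> a < n" "b < n" by blast
      then show False
      proof cases
        case 1
        then have "re_coords \<delta> a + re_coords \<delta> (b - n) = 0" "b - n < n"
          using s ab by (auto simp: signed_def)
        then show False using R 1 unfolding odd_regular_def by blast
      next
        case 2
        then have "re_coords \<delta> (a - n) + re_coords \<delta> b = 0" "a - n < n"
          using s ab by (auto simp: signed_def)
        then show False using R 2 unfolding odd_regular_def by blast
      qed
    qed
    then show "X \<in> periplectic_even n" using X unfolding levi_iff periplectic_even_iff by blast
  qed
qed

lemma cartan_subset_levi: "cartan n \<subseteq> levi n \<delta>"
proof
  fix X assume "X \<in> cartan n"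
  then show "X \<in> levi n \<delta>" unfolding cartan_iff levi_iff by metis
qed

lemma cartan_subset_even: "cartan n \<subseteq> periplectic_even n"
proof
  fix X assume "X \<in> cartan n"
  then show "X \<in> periplectic_even n" unfolding cartan_iff periplectic_even_iff by metis
qed

text \<open>Injectivity removes the even roots \<epsilon>_i - \<epsilon>_j from the Levi subalgebra,
  as regularity removes the odd ones.\<close>

lemma levi_cartan_iff:
  "levi n \<delta> = cartan n \<longleftrightarrow> odd_regular n (re_coords \<delta>) \<and> inj_on (re_coords \<delta>) {..<n}"
  (is "?L \<longleftrightarrow> ?R")
proof
  assume L: ?L
  have "odd_regular n (re_coords \<delta>)"
    using L cartan_subset_even levi_even_iff[of n \<delta>] by simp
  moreover have "inj_on (re_coords \<delta>) {..<n}"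
  proof (rule inj_onI)
    fix i j assume ij: "i \<in> {..<n}" "j \<in> {..<n}" and "re_coords \<delta> i = re_coords \<delta> j"
    then have "signed n (re_coords \<delta>) i = signed n (re_coords \<delta>) j" by (simp add: signed_def)
    moreover have al: "allowed n i j" using ij by (auto simp: allowed_def)
    ultimately have "root_matrix n i j \<in> cartan n" using L root_matrix_levi by blast
    then show "i = j"
      by (rule cartan_iff[THEN iffD1, THEN conjunct2, rule_format])
        (use ij root_matrix_nonzero[OF al] in auto)
  qed
  ultimately show ?R by blast
next
  assume R: ?R
  have "levi n \<delta> \<subseteq> cartan n"
  proof
    fix X assume X: "X \<in> levi n \<delta>"
    have "X \<in> periplectic_even n" using R X levi_even_iff[of n \<delta>] by blast
    then have even: "\<And>a b. a < 2*n \<Longrightarrow> b < 2*n \<Longrightarrow> X $$ (a, b) \<noteq> 0 \<Longrightarrow> a < n \<longleftrightarrow> b < n"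
      unfolding periplectic_even_iff by blast
    have "a = b" if ab: "a < 2*n" "b < 2*n" "X $$ (a, b) \<noteq> 0" for a b
    proof -
      have s: "signed n (re_coords \<delta>) a = signed n (re_coords \<delta>) b"
        by (rule levi_iff[THEN iffD1, OF X, THEN conjunct2, rule_format]) (use ab in auto)
      show ?thesis
      proof (cases "a < n")
        case True
        then have "b < n" using even[OF ab] by simp
        then show ?thesis using s True R by (auto simp: signed_def inj_on_def)
      next
        case False
        then have b: "\<not> b < n" using even[OF ab] by simp
        then have "re_coords \<delta> (a - n) = re_coords \<delta> (b - n)" using s False by (simp add: signed_def)
        moreover have "a - n \<in> {..<n}" "b - n \<in> {..<n}" using ab by auto
        ultimately have "a - n = b - n" using R by (blast dest: inj_onD)
        then show ?thesis using False b by simp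
      qed
    qed
    then show "X \<in> cartan n" using X unfolding levi_iff cartan_iff by blast
  qed
  then show ?L using cartan_subset_levi by blast
qed

text \<open>The only sign not determined by a parabolic subalgebra alone is that of a root \<open>2\<epsilon>\<close>,
  whose negative is not a root; it can be read off as soon as it is nonzero.\<close>

lemma same_order_of_reduced_parabolic:
  assumes P: "parabolic n \<delta> = parabolic n \<delta>'"
    and reg: "odd_regular n (re_coords \<delta>)" "odd_regular n (re_coords \<delta>')"
  shows "same_order n (re_coords \<delta>) (re_coords \<delta>')"
proof (rule same_order_of_parabolic[OF P])
  fix a b assume "allowed n a b" "\<not> allowed n b a"
  then have ab: "a < n" "b = a + n" by (auto simp: allowed_def flip_def split: if_splits)
  have "re_coords \<delta> a + re_coords \<delta> a \<noteq> 0" "re_coords \<delta>' a + re_coords \<delta>' a \<noteq> 0"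
    using reg ab(1) unfolding odd_regular_def by blast+
  then show "signed n (re_coords \<delta>) a = signed n (re_coords \<delta>) b
      \<longleftrightarrow> signed n (re_coords \<delta>') a = signed n (re_coords \<delta>') b"
    using ab by (simp add: signed_def)
qed

text \<open>With distinct coordinates dominance becomes strict, so no strictly lower triangular
  entry survives. This reduces the prescribed even part to the inclusion used in the other two
  bijections.\<close>

lemma borel_even_part_iff:
  assumes "levi n \<delta> = cartan n"
  shows "parabolic n \<delta> \<inter> periplectic_even n = std_even_borel n
    \<longleftrightarrow> std_even_borel n \<subseteq> parabolic n \<delta>"
proof
  assume sub: "std_even_borel n \<subseteq> parabolic n \<delta>"
  have inj: "inj_on (re_coords \<delta>) {..<n}" using assms levi_cartan_iff by blast
  have dom: "dominant n (re_coords \<delta>)" using sub std_even_borel_subset_iff by blast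
  have "X \<in> std_even_borel n" if X: "X \<in> parabolic n \<delta>" "X \<in> periplectic_even n" for X
  proof -
    have "a \<le> b" if ab: "a < n" "b < n" "X $$ (a, b) \<noteq> 0" for a b
    proof (rule ccontr)
      assume "\<not> a \<le> b"
      then have "re_coords \<delta> a \<le> re_coords \<delta> b" using dom ab unfolding dominant_def by auto
      moreover have "signed n (re_coords \<delta>) b \<le> signed n (re_coords \<delta>) a"
        by (rule parabolic_iff[THEN iffD1, OF X(1), THEN conjunct2, rule_format]) (use ab in auto)
      ultimately have "re_coords \<delta> a = re_coords \<delta> b" using ab by (simp add: signed_def)
      then show False using inj_onD[OF inj, of a b] ab \<open>\<not> a \<le> b\<close> by simp
    qed
    then show ?thesis using X(2) unfolding std_even_borel_iff by blast
  qed
  moreover have "std_even_borel n \<subseteq> periplectic_even n"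
    using std_even_borel_iff by blast
  ultimately show "parabolic n \<delta> \<inter> periplectic_even n = std_even_borel n" using sub by blast
qed blast

section \<open>Bipartition weights as representatives of dominant orders\<close>

lemma zeta_carrier: "zeta n x \<in> cartan_dual n"
  by (simp add: zeta_def)

lemma re_coords_zeta: "k < n \<Longrightarrow> re_coords (zeta n x) k = of_int (int_coords n x k)"
  by (simp add: re_coords_def zeta_def int_coords_def)

lemma signed_cong: "(\<And>k. k < n \<Longrightarrow> d k = d' k) \<Longrightarrow> a < 2 * n \<Longrightarrow> signed n d a = signed n d' a"
  by (auto simp: signed_def)

text \<open>The real coordinates of a vector are compared with integer functions that are known to
  agree with them only at indices below n.\<close>

lemma same_order_cong:
  assumes "\<And>k. k < n \<Longrightarrow> d k = e k" "\<And>k. k < n \<Longrightarrow> d' k = e' k"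
  shows "same_order n d d' \<longleftrightarrow> same_order n e e'"
  unfolding same_order_def using signed_cong[of n d e] signed_cong[of n d' e'] assms by simp

lemma same_order_dominant:
  assumes "same_order n d d'" "dominant n d"
  shows "dominant n d'"
  using assms same_order_coords(1)[OF assms(1)] unfolding dominant_def by (meson le_less_trans)

lemma zeta_inj:
  assumes "x \<in> BRP n" "y \<in> BRP n" "same_order n (re_coords (zeta n x)) (re_coords (zeta n y))"
  shows "x = y"
proof (rule int_coords_inj[OF assms(1,2)])
  have "same_order n (\<lambda>k. of_int (int_coords n x k)) (\<lambda>k. of_int (int_coords n y k))"
    by (rule same_order_cong[THEN iffD1, OF _ _ assms(3)]) (simp_all add: re_coords_zeta)
  then show "int_coords n x k = int_coords n y k" if "k < n" for k
    by (rule consecutive_unique[OF int_coords_consecutive[OF assms(1)]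
          int_coords_consecutive[OF assms(2)] _ that])
qed

text \<open>Dominance depends only on the order, so the gap-free integral representative inherits it
  and comes from a bipartition.\<close>

lemma zeta_surj:
  assumes dom: "dominant n (re_coords \<delta>)"
  obtains x where "x \<in> BRP n" "same_order n (re_coords (zeta n x)) (re_coords \<delta>)"
proof -
  obtain z where z: "consecutive n z" "same_order n (re_coords \<delta>) (\<lambda>i. of_int (z i))"
    by (rule consecutive_exists)
  have "dominant n (\<lambda>i. of_int (z i) :: real)" by (rule same_order_dominant[OF z(2) dom])
  then have "dominant n z" by (simp add: dominant_def)
  then obtain x where x: "x \<in> BRP n" "\<And>k. k < n \<Longrightarrow> int_coords n x k = z k"
    using int_coords_surj z(1) by blast
  have "same_order n (re_coords (zeta n x)) (re_coords \<delta>)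
      \<longleftrightarrow> same_order n (\<lambda>i. of_int (z i)) (re_coords \<delta>)"
    by (rule same_order_cong) (simp_all add: re_coords_zeta x(2))
  then show thesis using that x(1) same_order_sym[OF z(2)] by blast
qed

lemma BRP_dominant:
  assumes "x \<in> BRP n"
  shows "dominant n (re_coords (zeta n x))"
  using int_coords_dominant[OF assms] by (auto simp: dominant_def re_coords_zeta)

lemma BRP0_odd_regular_iff:
  assumes "x \<in> BRP n"
  shows "x \<in> BRP0 n \<longleftrightarrow> odd_regular n (re_coords (zeta n x))"
proof -
  have "odd_regular n (re_coords (zeta n x)) \<longleftrightarrow> odd_regular n (int_coords n x)"
    unfolding odd_regular_def
    by (simp add: re_coords_zeta flip: of_int_add)
  then show ?thesis using BRP0_iff[OF assms] by (simp add: odd_regular_def)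
qed

lemma BRP00_regular_iff:
  assumes "x \<in> BRP n"
  shows "x \<in> BRP00 n \<longleftrightarrow> odd_regular n (re_coords (zeta n x)) \<and> inj_on (re_coords (zeta n x)) {..<n}"
proof -
  have "inj_on (re_coords (zeta n x)) {..<n}
      \<longleftrightarrow> (\<forall>i<n. \<forall>j<n. i \<noteq> j \<longrightarrow> int_coords n x i \<noteq> int_coords n x j)"
    unfolding inj_on_def by (auto simp: re_coords_zeta)
  then show ?thesis
    using BRP00_iff[OF assms] BRP0_iff[OF assms] BRP0_odd_regular_iff[OF assms] by simp
qed

lemma BRP0_subset: "BRP0 n \<subseteq> BRP n"
  by (auto simp: BRP0_def)

lemma BRP00_subset: "BRP00 n \<subseteq> BRP0 n"
  by (auto simp: BRP00_def)

section \<open>The three bijections\<close>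

lemma parabolic_decompositions_bij:
  "bij_betw (\<lambda>x. (parabolic n (zeta n x), levi n (zeta n x)))
     (BRP n) {(p, l) \<in> parabolic_decompositions n. std_even_borel n \<subseteq> p}"
  unfolding bij_betw_def
proof
  show "inj_on (\<lambda>x. (parabolic n (zeta n x), levi n (zeta n x))) (BRP n)"
    by (rule inj_onI) (use zeta_inj parabolic_levi_eq_iff in blast)
  show "(\<lambda>x. (parabolic n (zeta n x), levi n (zeta n x))) ` BRP n
      = {(p, l) \<in> parabolic_decompositions n. std_even_borel n \<subseteq> p}" (is "?f ` _ = ?B")
  proof (intro Set.equalityI subsetI)
    fix q assume "q \<in> ?f ` BRP n"
    then obtain x where x: "x \<in> BRP n" "q = ?f x" by blast
    then have "q \<in> parabolic_decompositions n"
      using zeta_carrier unfolding parabolic_decompositions_def by blast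
    moreover have "std_even_borel n \<subseteq> parabolic n (zeta n x)"
      using std_even_borel_subset_iff BRP_dominant[OF x(1)] by blast
    ultimately show "q \<in> ?B" using x(2) by simp
  next
    fix q assume "q \<in> ?B"
    then obtain \<delta> where q: "q = (parabolic n \<delta>, levi n \<delta>)" "std_even_borel n \<subseteq> parabolic n \<delta>"
      unfolding parabolic_decompositions_def by blast
    then obtain x where "x \<in> BRP n" "same_order n (re_coords (zeta n x)) (re_coords \<delta>)"
      using zeta_surj std_even_borel_subset_iff by blast
    then show "q \<in> ?f ` BRP n"
      unfolding q(1) using parabolic_levi_cong by (intro image_eqI[of _ _ x]) auto
  qed
qed

lemma parabolic_inj_on_BRP0: "inj_on (\<lambda>x. parabolic n (zeta n x)) (BRP0 n)"
proof (rule inj_onI)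
  fix x y assume xy: "x \<in> BRP0 n" "y \<in> BRP0 n" and P: "parabolic n (zeta n x) = parabolic n (zeta n y)"
  then have BRP: "x \<in> BRP n" "y \<in> BRP n" using BRP0_subset by blast+
  show "x = y"
    by (rule zeta_inj[OF BRP same_order_of_reduced_parabolic[OF P]])
      (use xy BRP BRP0_odd_regular_iff in blast)+
qed

lemma reduced_parabolics_bij:
  "bij_betw (\<lambda>x. parabolic n (zeta n x)) (BRP0 n) {p \<in> reduced_parabolics n. std_even_borel n \<subseteq> p}"
  unfolding bij_betw_def
proof
  show "(\<lambda>x. parabolic n (zeta n x)) ` BRP0 n = {p \<in> reduced_parabolics n. std_even_borel n \<subseteq> p}"
    (is "?f ` _ = ?B")
  proof (intro Set.equalityI subsetI)
    fix p assume "p \<in> ?f ` BRP0 n"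
    then obtain x where x: "x \<in> BRP0 n" "x \<in> BRP n" "p = ?f x" using BRP0_subset by blast
    then have "levi n (zeta n x) \<subseteq> periplectic_even n"
      using BRP0_odd_regular_iff levi_even_iff by blast
    then have "p \<in> reduced_parabolics n"
      using zeta_carrier x(3) unfolding reduced_parabolics_def by blast
    moreover have "std_even_borel n \<subseteq> p"
      using std_even_borel_subset_iff BRP_dominant[OF x(2)] x(3) by blast
    ultimately show "p \<in> ?B" by blast
  next
    fix p assume "p \<in> ?B"
    then obtain \<delta> where p: "p = parabolic n \<delta>" "std_even_borel n \<subseteq> parabolic n \<delta>"
      and even: "levi n \<delta> \<subseteq> periplectic_even n"
      unfolding reduced_parabolics_def by blast
    then obtain x where x: "x \<in> BRP n" "same_order n (re_coords (zeta n x)) (re_coords \<delta>)"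
      using zeta_surj std_even_borel_subset_iff by blast
    \<comment> \<open>Reducedness is witnessed by \<delta>; since equal orders have equal Levi
      subalgebras, the bipartition weight is a witness too.\<close>
    have "levi n (zeta n x) \<subseteq> periplectic_even n" using parabolic_levi_cong(2)[OF x(2)] even by simp
    then have "x \<in> BRP0 n" using BRP0_odd_regular_iff[OF x(1)] levi_even_iff by blast
    then show "p \<in> ?f ` BRP0 n"
      unfolding p(1) using parabolic_levi_cong(1)[OF x(2)] by (intro image_eqI[of _ _ x]) auto
  qed
qed (rule parabolic_inj_on_BRP0)

lemma borels_bij:
  "bij_betw (\<lambda>x. parabolic n (zeta n x)) (BRP00 n)
     {b \<in> borels n. b \<inter> periplectic_even n = std_even_borel n}"
  unfolding bij_betw_def
proof
  show "inj_on (\<lambda>x. parabolic n (zeta n x)) (BRP00 n)"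
    by (rule inj_on_subset[OF parabolic_inj_on_BRP0 BRP00_subset])
  show "(\<lambda>x. parabolic n (zeta n x)) ` BRP00 n
      = {b \<in> borels n. b \<inter> periplectic_even n = std_even_borel n}" (is "?f ` _ = ?B")
  proof (intro Set.equalityI subsetI)
    fix p assume "p \<in> ?f ` BRP00 n"
    then obtain x where x: "x \<in> BRP00 n" "x \<in> BRP n" "p = ?f x"
      using BRP0_subset BRP00_subset by blast
    then have cartan: "levi n (zeta n x) = cartan n"
      using BRP00_regular_iff levi_cartan_iff by blast
    then have "p \<in> borels n" using zeta_carrier x(3) unfolding borels_def by blast
    moreover have "std_even_borel n \<subseteq> ?f x"
      using std_even_borel_subset_iff BRP_dominant[OF x(2)] by blast
    ultimately show "p \<in> ?B" using borel_even_part_iff[OF cartan] x(3) by simp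
  next
    fix p assume "p \<in> ?B"
    then obtain \<delta> where p: "p = parabolic n \<delta>" and cartan: "levi n \<delta> = cartan n"
      and "parabolic n \<delta> \<inter> periplectic_even n = std_even_borel n"
      unfolding borels_def by blast
    then have "std_even_borel n \<subseteq> parabolic n \<delta>" by blast
    then obtain x where x: "x \<in> BRP n" "same_order n (re_coords (zeta n x)) (re_coords \<delta>)"
      using zeta_surj std_even_borel_subset_iff by blast
    have "levi n (zeta n x) = cartan n" using parabolic_levi_cong(2)[OF x(2)] cartan by simp
    then have "x \<in> BRP00 n" using BRP00_regular_iff[OF x(1)] levi_cartan_iff by blast
    then show "p \<in> ?f ` BRP00 n"
      unfolding p using parabolic_levi_cong(1)[OF x(2)] by (intro image_eqI[of _ _ x]) auto
  qed
qed

theorem theorem5p4: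
  fixes n :: nat
  assumes "n \<ge> 1"
  shows "bij_betw (\<lambda>x. (parabolic n (zeta n x), levi n (zeta n x)))
           (BRP n) {(p, l) \<in> parabolic_decompositions n. std_even_borel n \<subseteq> p}
       \<and> bij_betw (\<lambda>x. parabolic n (zeta n x))
           (BRP0 n) {p \<in> reduced_parabolics n. std_even_borel n \<subseteq> p}
       \<and> bij_betw (\<lambda>x. parabolic n (zeta n x))
           (BRP00 n) {b \<in> borels n. b \<inter> periplectic_even n = std_even_borel n}"
  using parabolic_decompositions_bij reduced_parabolics_bij borels_bij by blast

end
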